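(* Let $q\in\mathbb{N}$, let $\mathbb{X}\subset\mathbb{Z}^q$ (possibly countably infinite), let $\mathcal{F}$ be a class of probability mass functions (PMFs) on $\mathbb{X}$, and let $\boldsymbol{c}=\{c_S\}_{S\in\mathbb{S}}$ and $\boldsymbol{d}=\{d_T\}_{T\in\mathbb{T}}$ be families of constants in $[0,\infty)$ that are not both identically zero. Let $\mathbf{X}_n=\{\boldsymbol{X}_i\}_{i=1}^n$ be an independent and identically distributed sample from a distribution with PMF $f_0\in\mathcal{F}$. Suppose that the pseudo-entropy $H(f_0)$ is finite, and that all relevant marginal and conditional PMFs $\tilde f_n^S$ (those with $c_S\neq 0$, $S\in\mathbb{S}$) and $\tilde f_n^T(\cdot|\cdot)$ (those with $d_T\neq 0$, $T\in\mathbb{T}$) are compatible with $\tilde f_n\in\mathcal{F}$, where $\tilde f_n$ is the maximum pseudolikelihood estimator, that is, $L^{\boldsymbol{cd}}_{\tilde f_n}(\mathbf{X}_n)=\max_{f\in\mathcal{F}}L^{\boldsymbol{cd}}_f(\mathbf{X}_n)$. Then $\tilde f_n$ is a consistent estimator for $f_0$, meaning that, for all relevant $S$ and $T$ (i.e. $c_S\neq 0$ and $d_T\neq 0$), as $n\to\infty$, $$\tilde f_n^S(\boldsymbol{x}^S)\to f_0^S(\boldsymbol{x}^S)\quad\text{and}\quad \tilde f_n^T\left(\boldsymbol{x}^{\overleftarrow{T}}|\boldsymbol{x}^{\overrightarrow{T}}\right)\to f_0^T\left(\boldsymbol{x}^{\overleftarrow{T}}|\boldsymbol{x}^{\overrightarrow{T}}\right)$$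 with probability $1$, for every $\boldsymbol{x}^S\in\mathbb{X}^S$, every $\boldsymbol{x}^{\overleftarrow{T}}\in\mathbb{X}^{\overleftarrow{T}}$ and every $\boldsymbol{x}^{\overrightarrow{T}}\in\mathbb{X}^{\overrightarrow{T}}$.
   Context: Write $[q]=\{1,\dots,q\}$. $\mathbb{S}$ is the set of all non-empty subsets of $[q]$. $\mathbb{T}$ is the set of partitions of all subsets of $[q]$ into two non-empty sets; for $T\in\mathbb{T}$ the two sets are called the left set $\overleftarrow{T}$ and the right set $\overrightarrow{T}$. For a vector $\boldsymbol{x}$ and $A\subset[q]$, $\boldsymbol{x}^A$ is the subvector of the coordinates of $\boldsymbol{x}$ indexed by $A$, and $\mathbb{X}^A$ is the corresponding set of coordinates of $\mathbb{X}$, i.e. $\{\boldsymbol{x}^A:\boldsymbol{x}\in\mathbb{X}\}$. For a PMF $f$ on $\mathbb{X}$, $f^A$ is the marginal PMF of the coordinates in a non-empty $A\subset[q]$, and, for $T\in\mathbb{T}$, $f^T(\boldsymbol{x}^{\overleftarrow{T}}|\boldsymbol{x}^{\overrightarrow{T}})$ is the conditional PMF, under $f$, of the coordinates in $\overleftarrow{T}$ given that the coordinates in $\overrightarrow{T}$ equal $\boldsymbol{x}^{\overrightarrow{T}}$. Marginal and conditional PMFs $\tilde f_n^S$, $\tilde f_n^T(\cdot|\cdot)$ are compatible with $\tilde f_n$ if they can be computed from the joint PMF $\tilde f_n$ by the usual laws for deriving marginal and conditional PMFs. The (log-)pseudolikelihood function is $$L_f^{\boldsymbol{cd}}(\mathbf{X}_n)=\sum_{i=1}^n\sum_{S\in\mathbb{S}}c_S\log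 f^S(\boldsymbol{X}_i^S)+\sum_{i=1}^n\sum_{T\in\mathbb{T}}d_T\log f^T\left(\boldsymbol{X}_i^{\overleftarrow{T}}|\boldsymbol{X}_i^{\overrightarrow{T}}\right).$$ The maximum pseudolikelihood estimator $\tilde f_n$ is any element of $\mathcal{F}$ attaining the maximum of $L_f^{\boldsymbol{cd}}(\mathbf{X}_n)$ over $f\in\mathcal{F}$. The pseudo-entropy of $f\in\mathcal{F}$ is $$H(f)=\sum_{S\in\mathbb{S}}\sum_{\boldsymbol{x}^S\in\mathbb{X}^S}-c_Sf^S(\boldsymbol{x}^S)\log f^S(\boldsymbol{x}^S)+\sum_{T\in\mathbb{T}}d_T\sum_{\boldsymbol{x}^{\overrightarrow{T}}\in\mathbb{X}^{\overrightarrow{T}}}\ \sum_{\boldsymbol{x}^{\overleftarrow{T}}\in\mathbb{X}^{\overleftarrow{T}}}-f^T(\boldsymbol{x}^{\overleftarrow{T}}|\boldsymbol{x}^{\overrightarrow{T}})\log f^T(\boldsymbol{x}^{\overleftarrow{T}}|\boldsymbol{x}^{\overrightarrow{T}}),$$ with the convention $0\times\log 0=0$.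
   Formalization: The convergence of the conditional PMFs is stated only at right subvectors whose marginal probability under f_0 is positive, since f_0^T(·|x) is undefined at the others; a PMF f whose conditionals are undefined at a sample point has pseudolikelihood minus infinity. *)

theory Defs
  imports "HOL-Probability.Probability"
begin

text \<open>
  A vector in \<open>\<int>^q\<close> is an element of \<open>{1..q} \<rightarrow>\<^sub>E UNIV\<close>, and the subvector of \<open>x\<close> with
  coordinates in \<open>A\<close> is \<open>restrict x A\<close>.
\<close>

type_synonym ivec = "nat \<Rightarrow> int"

definition nonempty_subsets :: "nat \<Rightarrow> nat set set" where
  "nonempty_subsets q = {S. S \<noteq> {} \<and> S \<subseteq> {1..q}}"

text \<open>
  The two blocks of a partition are ordered: \<open>fst T\<close> is the left set, whose coordinates are
  conditioned on those in the right set \<open>snd T\<close>.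
\<close>

definition bipartitions :: "nat \<Rightarrow> (nat set \<times> nat set) set" where
  "bipartitions q = {(L, R). L \<noteq> {} \<and> R \<noteq> {} \<and> L \<inter> R = {} \<and> L \<union> R \<subseteq> {1..q}}"

definition subvectors :: "ivec set \<Rightarrow> nat set \<Rightarrow> ivec set" where
  "subvectors \<X> A = (\<lambda>x. restrict x A) ` \<X>"

definition marginal :: "nat set \<Rightarrow> ivec pmf \<Rightarrow> ivec pmf" where
  "marginal A f = map_pmf (\<lambda>x. restrict x A) f"

text \<open>
  The conditional PMF of the left coordinates at \<open>y\<close>, given that the right coordinates equal \<open>z\<close>.
  It takes the value 0 when the conditioning event has probability 0.
\<close>

definition conditional :: "nat set \<times> nat set \<Rightarrow> ivec pmf \<Rightarrow> ivec \<Rightarrow> ivec \<Rightarrow> real" where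
  "conditional T f y z =
     \<P>(x in measure_pmf f. restrict x (fst T) = y \<bar> restrict x (snd T) = z)"

text \<open>
  The logarithm of a probability, with \<open>log 0 = -\<infinity>\<close>. Since \<open>0 * (-\<infinity>) = 0\<close> in \<^typ>\<open>ereal\<close>,
  terms with a zero weight do not contribute to the pseudolikelihood.
\<close>

definition log_prob :: "real \<Rightarrow> ereal" where
  "log_prob p = (if p > 0 then ereal (ln p) else -\<infinity>)"

definition log_pseudolikelihood ::
  "nat \<Rightarrow> (nat set \<Rightarrow> real) \<Rightarrow> (nat set \<times> nat set \<Rightarrow> real) \<Rightarrow> nat \<Rightarrow> (nat \<Rightarrow> ivec) \<Rightarrow> ivec pmf \<Rightarrow> ereal"
where
  "log_pseudolikelihood q c d n x f =
     (\<Sum>i\<in>{1..n}. \<Sum>S\<in>nonempty_subsets q.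
        ereal (c S) * log_prob (pmf (marginal S f) (restrict (x i) S))) +
     (\<Sum>i\<in>{1..n}. \<Sum>T\<in>bipartitions q.
        ereal (d T) * log_prob (conditional T f (restrict (x i) (fst T)) (restrict (x i) (snd T))))"

definition is_max_pseudolikelihood ::
  "nat \<Rightarrow> (nat set \<Rightarrow> real) \<Rightarrow> (nat set \<times> nat set \<Rightarrow> real) \<Rightarrow> ivec pmf set \<Rightarrow>
    nat \<Rightarrow> (nat \<Rightarrow> ivec) \<Rightarrow> ivec pmf \<Rightarrow> bool"
where
  "is_max_pseudolikelihood q c d \<F> n x g \<longleftrightarrow>
     g \<in> \<F> \<and> (\<forall>f\<in>\<F>. log_pseudolikelihood q c d n x f \<le> log_pseudolikelihood q c d n x g)"

text \<open>
  All summands are nonnegative, as \<open>- (p * ln p) \<ge> 0\<close> for \<open>p \<in> [0, 1]\<close>, so that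
  \<^const>\<open>ennreal\<close> does not truncate; and \<open>0 * ln 0 = 0\<close> holds for real numbers.
  The conditional terms are not weighted by the probability of the conditioning event.
\<close>

definition pseudo_entropy ::
  "nat \<Rightarrow> ivec set \<Rightarrow> (nat set \<Rightarrow> real) \<Rightarrow> (nat set \<times> nat set \<Rightarrow> real) \<Rightarrow> ivec pmf \<Rightarrow> ennreal"
where
  "pseudo_entropy q \<X> c d f =
     (\<Sum>S\<in>nonempty_subsets q. \<Sum>\<^sub>\<infinity>x\<in>subvectors \<X> S.
        ennreal (- (c S * (pmf (marginal S f) x * ln (pmf (marginal S f) x))))) +
     (\<Sum>T\<in>bipartitions q. ennreal (d T) *
        (\<Sum>\<^sub>\<infinity>z\<in>subvectors \<X> (snd T). \<Sum>\<^sub>\<infinity>y\<in>subvectors \<X> (fst T).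
           ennreal (- (conditional T f y z * ln (conditional T f y z)))))"

text \<open>
  Families of marginal PMFs \<open>g\<^sub>S\<close> and conditional PMFs \<open>g\<^sub>T(\<cdot>|\<cdot>)\<close> compatible with a joint PMF.
  Only the sets and partitions of nonzero weight are constrained, and conditional PMFs only where
  the conditioning event has positive probability.
\<close>

definition compatible ::
  "nat \<Rightarrow> ivec set \<Rightarrow> (nat set \<Rightarrow> real) \<Rightarrow> (nat set \<times> nat set \<Rightarrow> real) \<Rightarrow> ivec pmf \<Rightarrow>
    (nat set \<Rightarrow> ivec \<Rightarrow> real) \<Rightarrow> (nat set \<times> nat set \<Rightarrow> ivec \<Rightarrow> ivec \<Rightarrow> real) \<Rightarrow> bool"
where
  "compatible q \<X> c d f gS gT \<longleftrightarrow>
     (\<forall>S\<in>nonempty_subsets q. c S \<noteq> 0 \<longrightarrow>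
        (\<forall>x\<in>subvectors \<X> S. gS S x = pmf (marginal S f) x)) \<and>
     (\<forall>T\<in>bipartitions q. d T \<noteq> 0 \<longrightarrow>
        (\<forall>z\<in>subvectors \<X> (snd T). pmf (marginal (snd T) f) z > 0 \<longrightarrow>
          (\<forall>y\<in>subvectors \<X> (fst T). gT T y z = conditional T f y z)))"

end

theory Submission
  imports Defs
begin

text \<open>
  Let \<open>p\<^sub>n\<close> be the empirical distribution of the sample. Up to terms that do not depend on \<open>f\<close>, the
  pseudolikelihood of \<open>f\<close> is \<open>- n\<close> times a weighted sum of conditional divergences \<open>D\<^sub>T(p\<^sub>n, f)\<close>, so the
  maximizer satisfies \<open>\<Sum> w\<^sub>T D\<^sub>T(p\<^sub>n, f\<^sub>n) \<le> \<Sum> w\<^sub>T D\<^sub>T(p\<^sub>n, f\<^sub>0)\<close>. The right-hand side has nonpositive upper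
  limit: the cross entropy of \<open>p\<^sub>n\<close> relative to \<open>f\<^sub>0\<close> converges to the entropy of \<open>f\<^sub>0\<close> by the strong law of
  large numbers (this uses the finite pseudo-entropy), and the entropy is lower semicontinuous.
  Hence every \<open>D\<^sub>T(p\<^sub>n, f\<^sub>n)\<close> of positive weight tends to 0. It dominates a squared Hellinger distance,
  so \<open>f\<^sub>n\<close> has the same limit as \<open>p\<^sub>n\<close>.
\<close>

section \<open>The strong law of large numbers\<close>

text \<open>This is the maximum of the partial sums with at most \<open>n\<close> terms, the empty
  one included. Peeling off the first term leaves the same functional of the shifted sequence, which
  is the form that Garsia's argument needs.\<close>

primrec max_partial_sum :: "nat \<Rightarrow> (nat \<Rightarrow> real) \<Rightarrow> real" where
  "max_partial_sum 0 s = 0"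
| "max_partial_sum (Suc n) s = max 0 (s 0 + max_partial_sum n (\<lambda>i. s (Suc i)))"

lemma max_partial_sum_nonneg: "max_partial_sum n s \<ge> 0"
  by (cases n) auto

lemma max_partial_sum_mono: "max_partial_sum n s \<le> max_partial_sum (Suc n) s"
proof (induction n arbitrary: s)
  case (Suc n)
  show ?case using Suc[of "\<lambda>i. s (Suc i)"]
    by (simp del: max_partial_sum.simps(2) add: max_partial_sum.simps(2)[of _ s])
qed simp

lemma incseq_max_partial_sum: "incseq (\<lambda>n. max_partial_sum n s)"
  by (intro incseq_SucI max_partial_sum_mono)

lemma partial_sum_le_max: "(\<Sum>i<n. s i) \<le> max_partial_sum n s"
proof (induction n arbitrary: s)
  case (Suc n)
  show ?case using Suc[of "\<lambda>i. s (Suc i)"]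
    by (subst sum.lessThan_Suc_shift) simp
qed simp

lemma abs_max_partial_sum_le: "\<bar>max_partial_sum n s\<bar> \<le> (\<Sum>i<n. \<bar>s i\<bar>)"
proof (induction n arbitrary: s)
  case (Suc n)
  show ?case using Suc[of "\<lambda>i. s (Suc i)"]
    by (subst sum.lessThan_Suc_shift) auto
qed simp

lemma measurable_max_partial_sum:
  "(\<And>i. X i \<in> borel_measurable M) \<Longrightarrow> (\<lambda>\<omega>. max_partial_sum n (\<lambda>i. X i \<omega>)) \<in> borel_measurable M"
proof (induction n arbitrary: X)
  case (Suc n)
  from Suc.IH[of "\<lambda>i. X (Suc i)"] Suc.prems show ?case by simp
qed simp

text \<open>Dropping \<open>k\<close> terms changes all later partial sums by the same constant.
  Boundedness is therefore a tail property.\<close>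

lemma bdd_above_partial_sums_shift:
  fixes s :: "nat \<Rightarrow> real"
  shows "bdd_above (range (\<lambda>n. \<Sum>i<n. s (i + k))) \<longleftrightarrow> bdd_above (range (\<lambda>n. \<Sum>i<n. s i))"
proof
  have eq: "(\<Sum>i<n + k. s i) = (\<Sum>i<k. s i) + (\<Sum>i<n. s (i + k))" for n
  proof -
    have "(\<Sum>i<n + k. s i) = (\<Sum>i<k. s i) + sum s {k..<n + k}"
      by (metis atLeast0LessThan le_add2 sum.atLeastLessThan_concat zero_le)
    also have "sum s {k..<n + k} = (\<Sum>i<n. s (i + k))"
      using sum.shift_bounds_nat_ivl[of s 0 k n] by (simp add: atLeast0LessThan)
    finally show ?thesis .
  qed
  { assume "bdd_above (range (\<lambda>n. \<Sum>i<n. s (i + k)))"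
    then obtain B where B: "\<And>n. (\<Sum>i<n. s (i + k)) \<le> B" by (auto simp: bdd_above_def)
    \<comment> \<open>Absolute values let one constant serve both cases: for
      \<open>n \<le> k\<close> the bound \<open>B\<close> on the shifted sums gives no
      information.\<close>
    have "(\<Sum>i<n. s i) \<le> (\<Sum>i<k. \<bar>s i\<bar>) + \<bar>B\<bar>" for n
    proof (cases "n \<le> k")
      case True
      have "(\<Sum>i<n. s i) \<le> (\<Sum>i<n. \<bar>s i\<bar>)" by (intro sum_mono) auto
      also have "\<dots> \<le> (\<Sum>i<k. \<bar>s i\<bar>)" using True by (intro sum_mono2) auto
      finally show ?thesis by simp
    next
      case False
      then have "(\<Sum>i<n. s i) = (\<Sum>i<k. s i) + (\<Sum>i<n - k. s (i + k))" using eq[of "n - k"] by simp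
      moreover have "(\<Sum>i<k. s i) \<le> (\<Sum>i<k. \<bar>s i\<bar>)" by (intro sum_mono) auto
      ultimately show ?thesis using B[of "n - k"] by linarith
    qed
    then show "bdd_above (range (\<lambda>n. \<Sum>i<n. s i))" by (intro bdd_aboveI2) }
  { assume "bdd_above (range (\<lambda>n. \<Sum>i<n. s i))"
    then obtain B where B: "\<And>n. (\<Sum>i<n. s i) \<le> B" by (auto simp: bdd_above_def)
    have "(\<Sum>i<n. s (i + k)) \<le> B - (\<Sum>i<k. s i)" for n using eq[of n] B[of "n + k"] by simp
    then show "bdd_above (range (\<lambda>n. \<Sum>i<n. s (i + k)))" by (intro bdd_aboveI2) }
qed

text \<open>Independence is a condition on finite subfamilies, and an injective \<open>f\<close>
  carries a finite \<open>J\<close> to its image without merging indices. It serves to shift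
  sequences by one.\<close>

lemma (in prob_space) indep_vars_reindex:
  assumes "inj_on f I" and "indep_vars M' X (f ` I)"
  shows "indep_vars (M' \<circ> f) (X \<circ> f) I"
  unfolding indep_vars_def2
proof (intro conjI ballI indep_setsI)
  let ?F = "\<lambda>i. {X i -` A \<inter> space M |A. A \<in> sets (M' i)}"
  have indep: "indep_sets ?F (f ` I)" and rv: "\<And>i. i \<in> I \<Longrightarrow> random_variable (M' (f i)) (X (f i))"
    using assms by (auto simp: indep_vars_def2)
  show "random_variable ((M' \<circ> f) i) ((X \<circ> f) i)" if "i \<in> I" for i using rv[OF that] by simp
  show "{(X \<circ> f) i -` A \<inter> space M |A. A \<in> sets ((M' \<circ> f) i)} \<subseteq> events" if "i \<in> I" for i
    using rv[OF that] by (auto intro: measurable_sets)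
  fix A J assume J: "J \<noteq> {}" "J \<subseteq> I" "finite J"
    and A: "\<forall>j\<in>J. A j \<in> {(X \<circ> f) j -` A \<inter> space M |A. A \<in> sets ((M' \<circ> f) j)}"
  define g where "g = the_inv_into J f"
  have inj: "inj_on f J" using assms(1) J(2) by (rule inj_on_subset)
  have g: "g (f j) = j" if "j \<in> J" for j using the_inv_into_f_f[OF inj that] by (simp add: g_def)
  have "prob (\<Inter>j\<in>J. A j) = prob (\<Inter>k\<in>f ` J. A (g k))" using g by simp
  also have "\<dots> = (\<Prod>k\<in>f ` J. prob (A (g k)))"
    using J A g by (intro indep_setsD[OF indep]) auto
  also have "\<dots> = (\<Prod>j\<in>J. prob (A j))"
    using g by (subst prod.reindex[OF inj]) simp
  finally show "prob (\<Inter>j\<in>J. A j) = (\<Prod>j\<in>J. prob (A j))" .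
qed

text \<open>Discarding the first \<open>k\<close> variables does not change the event, so it lies in
  every tail sigma-algebra and Kolmogorov's 0-1 law applies.\<close>

lemma (in prob_space) prob_bdd_above_partial_sums_0_1:
  fixes Y :: "nat \<Rightarrow> 'a \<Rightarrow> real"
  assumes indep: "indep_vars (\<lambda>_. borel) Y UNIV"
  defines "B \<equiv> {\<omega>\<in>space M. bdd_above (range (\<lambda>n. \<Sum>i<n. Y i \<omega>))}"
  shows "prob B = 0 \<or> prob B = 1"
proof (rule kolmogorov_0_1_law)
  let ?A = "\<lambda>i. sigma_sets (space M) {Y i -` A \<inter> space M | A. A \<in> sets borel}"
  show "sigma_algebra (space M) (?A i)" for i by (intro sigma_algebra_sigma_sets) auto
  show "indep_sets ?A UNIV" using indep unfolding indep_vars_def by auto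
  show "B \<in> tail_events ?A"
    unfolding tail_events_def
  proof safe
    fix k
    let ?N = "sigma (space M) (\<Union>i\<in>{k..}. ?A i)"
    have sub: "(\<Union>i\<in>{k..}. ?A i) \<subseteq> Pow (space M)"
      using sigma_sets_into_sp[of "{Y i -` A \<inter> space M | A. A \<in> sets borel}" "space M" for i] by blast
    have sN: "sets ?N = sigma_sets (space M) (\<Union>i\<in>{k..}. ?A i)" using sub by (rule sets_measure_of)
    have [simp]: "space ?N = space M" using sub by (rule space_measure_of)
    have meas: "(\<lambda>\<omega>. Y (i + k) \<omega>) \<in> borel_measurable ?N" for i
    proof (rule measurableI)
      fix A :: "real set" assume "A \<in> sets borel"
      then have "Y (i + k) -` A \<inter> space M \<in> ?A (i + k)" by blast
      then show "Y (i + k) -` A \<inter> space ?N \<in> sets ?N" unfolding sN by (auto intro!: sigma_sets.Basic bexI[of _ "i + k"])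
    qed auto
    \<comment> \<open>Bounds may be taken to be natural numbers, so the event is a countable union
      of countable intersections of events in \<open>?N\<close>.\<close>
    have "B = {\<omega>\<in>space ?N. \<exists>b::nat. \<forall>n. (\<Sum>i<n. Y (i + k) \<omega>) \<le> real b}"
    proof -
      have "bdd_above (range f) \<longleftrightarrow> (\<exists>b::nat. \<forall>n. f n \<le> real b)" for f :: "nat \<Rightarrow> real"
        by (auto simp: bdd_above_def) (meson order_trans real_arch_simple)
      then show ?thesis
        unfolding B_def using bdd_above_partial_sums_shift[where s = "\<lambda>i. Y i _" and k = k] by auto
    qed
    also have "\<dots> \<in> sets ?N" using meas by measurable
    finally show "B \<in> sigma_sets (space M) (\<Union>i\<in>{k..}. ?A i)" unfolding sN .
  qed
qed

text \<open>
  Garsia's argument: subtracting the maximum of the shifted sums, which has the same law, shows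
  \<open>E[max (- M\<^sub>n') Y\<^sub>0] \<ge> 0\<close>, and the integrand tends to \<open>Y\<^sub>0\<close> if the partial sums are unbounded.
\<close>

lemma (in prob_space) AE_bdd_above_partial_sums:
  fixes Y :: "nat \<Rightarrow> 'a \<Rightarrow> real"
  assumes indep: "indep_vars (\<lambda>_. borel) Y UNIV"
    and ident: "\<And>i. distr M borel (Y i) = distr M borel (Y 0)"
    and int0: "integrable M (Y 0)"
    and neg: "expectation (Y 0) < 0"
  shows "AE \<omega> in M. bdd_above (range (\<lambda>n. \<Sum>i<n. Y i \<omega>))"
proof -
  have rv [measurable]: "Y i \<in> borel_measurable M" for i
    using indep by (auto simp: indep_vars_def)
  have int: "integrable M (Y i)" for i
  proof -
    have "integrable (distr M borel (Y i)) (\<lambda>x. x)"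
      unfolding ident[of i] using int0 by (subst integrable_distr_eq) auto
    then show ?thesis by (subst (asm) integrable_distr_eq) auto
  qed
  let ?P = "PiM UNIV (\<lambda>_. borel) :: (nat \<Rightarrow> real) measure"
  have indep': "indep_vars (\<lambda>_. borel) (\<lambda>i. Y (Suc i)) UNIV"
  proof -
    have "indep_vars (\<lambda>_. borel) Y (range Suc)" by (rule indep_vars_subset[OF indep]) auto
    from indep_vars_reindex[OF _ this] show ?thesis by (simp add: comp_def)
  qed
  \<comment> \<open>By independence both laws are infinite products, and their factors agree by
    identical distribution.\<close>
  have same: "distr M ?P (\<lambda>\<omega> i. Y i \<omega>) = distr M ?P (\<lambda>\<omega> i. Y (Suc i) \<omega>)"
  proof -
    have "distr M ?P (\<lambda>\<omega> i. Y i \<omega>) = PiM UNIV (\<lambda>i. distr M borel (Y i))"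
      using indep_vars_iff_distr_eq_PiM[of UNIV Y "\<lambda>_. borel"] indep by (simp add: restrict_def)
    also have "(\<lambda>i. distr M borel (Y i)) = (\<lambda>i. distr M borel (Y (Suc i)))"
      using ident by metis
    also have "PiM UNIV (\<lambda>i. distr M borel (Y (Suc i))) = distr M ?P (\<lambda>\<omega> i. Y (Suc i) \<omega>)"
      using indep_vars_iff_distr_eq_PiM[of UNIV "\<lambda>i. Y (Suc i)" "\<lambda>_. borel"] indep' by (simp add: restrict_def)
    finally show ?thesis .
  qed
  define m where "m n \<omega> = max_partial_sum n (\<lambda>i. Y i \<omega>)" for n \<omega>
  define m' where "m' n \<omega> = max_partial_sum n (\<lambda>i. Y (Suc i) \<omega>)" for n \<omega>
  have m_meas [measurable]: "m n \<in> borel_measurable M" "m' n \<in> borel_measurable M" for n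
    unfolding m_def m'_def by (intro measurable_max_partial_sum; simp)+
  have m_int: "integrable M (m n)" for n
    by (rule Bochner_Integration.integrable_bound[of M "\<lambda>\<omega>. \<Sum>i<n. \<bar>Y i \<omega>\<bar>"])
       (use int abs_max_partial_sum_le[of n] in \<open>auto simp: m_def intro!: AE_I2 order_trans[OF _ abs_ge_self]\<close>)
  have m'_int: "integrable M (m' n)" for n
    by (rule Bochner_Integration.integrable_bound[of M "\<lambda>\<omega>. \<Sum>i<n. \<bar>Y (Suc i) \<omega>\<bar>"])
       (use int abs_max_partial_sum_le[of n] in \<open>auto simp: m'_def intro!: AE_I2 order_trans[OF _ abs_ge_self]\<close>)
  have E_eq: "expectation (m n) = expectation (m' n)" for n
  proof -
    have meas: "max_partial_sum n \<in> borel_measurable ?P"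
      using measurable_max_partial_sum[of "\<lambda>i s. s i" ?P n] by simp
    have "expectation (m n) = integral\<^sup>L (distr M ?P (\<lambda>\<omega> i. Y i \<omega>)) (max_partial_sum n)"
      unfolding m_def using meas by (subst integral_distr) (auto intro!: measurable_PiM_single')
    also have "\<dots> = expectation (m' n)"
      unfolding m'_def same using meas by (subst integral_distr) (auto intro!: measurable_PiM_single')
    finally show ?thesis .
  qed
  \<comment> \<open>The recursion gives \<open>m (Suc n) - m' n = max 0 (Y 0 + m' n) - m' n = max (-
    m' n) (Y 0)\<close>; \<open>m' n\<close> may stand in for \<open>m n\<close> because the
    expectations agree.\<close>
  have key: "0 \<le> expectation (\<lambda>\<omega>. max (- m' n \<omega>) (Y 0 \<omega>))" for n
  proof -
    have "0 \<le> expectation (m (Suc n)) - expectation (m n)"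
      using m_int by (simp add: m_def max_partial_sum_mono integral_mono del: max_partial_sum.simps)
    also have "\<dots> = expectation (\<lambda>\<omega>. m (Suc n) \<omega> - m' n \<omega>)"
      unfolding E_eq[of n] using m_int m'_int by simp
    also have "\<dots> = expectation (\<lambda>\<omega>. max (- m' n \<omega>) (Y 0 \<omega>))"
      by (intro Bochner_Integration.integral_cong) (auto simp: m_def m'_def)
    finally show ?thesis .
  qed
  let ?b = "\<lambda>\<omega>. bdd_above (range (\<lambda>n. \<Sum>i<n. Y i \<omega>))"
  have b_meas: "{\<omega>\<in>space M. ?b \<omega>} \<in> sets M"
  proof -
    have "bdd_above (range f) \<longleftrightarrow> (\<exists>b::nat. \<forall>n. f n \<le> real b)" for f :: "nat \<Rightarrow> real"
      by (auto simp: bdd_above_def) (meson order_trans real_arch_simple)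
    then show ?thesis by simp
  qed
  \<comment> \<open>By the 0-1 law it suffices to refute probability 0.\<close>
  have "prob {\<omega>\<in>space M. ?b \<omega>} \<noteq> 0"
  proof
    assume "prob {\<omega>\<in>space M. ?b \<omega>} = 0"
    then have "AE \<omega> in M. \<not> ?b \<omega>" using b_meas by (simp add: prob_eq_0)
    then have AE: "AE \<omega> in M. filterlim (\<lambda>n. m' n \<omega>) at_top sequentially"
    proof (rule AE_mp, intro AE_I2 impI)
      fix \<omega> assume "\<not> ?b \<omega>"
      then have nb: "\<not> bdd_above (range (\<lambda>n. \<Sum>i<n. Y (Suc i) \<omega>))"
        using bdd_above_partial_sums_shift[of "\<lambda>i. Y i \<omega>" 1] by simp
      show "filterlim (\<lambda>n. m' n \<omega>) at_top sequentially"
        unfolding filterlim_at_top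
      proof
        fix Z
        obtain N where "Z < (\<Sum>i<N. Y (Suc i) \<omega>)"
          using nb by (meson bdd_aboveI2 not_le)
        then have "Z \<le> m' N \<omega>"
          unfolding m'_def using partial_sum_le_max[of "\<lambda>i. Y (Suc i) \<omega>" N] by linarith
        then have "Z \<le> m' n \<omega>" if "n \<ge> N" for n
          using incseqD[OF incseq_max_partial_sum that, of "\<lambda>i. Y (Suc i) \<omega>"] by (simp add: m'_def)
        then show "\<forall>\<^sub>F n in sequentially. Z \<le> m' n \<omega>" unfolding eventually_sequentially by blast
      qed
    qed
    \<comment> \<open>Since \<open>m' n \<ge> 0\<close>, the integrand equals \<open>Y 0\<close>
      where that is nonnegative and lies between \<open>Y 0\<close> and 0 elsewhere, so the absolute
      value of \<open>Y 0\<close> dominates it.\<close>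
    have "(\<lambda>n. expectation (\<lambda>\<omega>. max (- m' n \<omega>) (Y 0 \<omega>))) \<longlonglongrightarrow> expectation (Y 0)"
    proof (rule integral_dominated_convergence[where w = "\<lambda>\<omega>. \<bar>Y 0 \<omega>\<bar>"])
      show "AE \<omega> in M. (\<lambda>n. max (- m' n \<omega>) (Y 0 \<omega>)) \<longlonglongrightarrow> Y 0 \<omega>"
        using AE
      proof (rule AE_mp, intro AE_I2 impI)
        fix \<omega> assume "filterlim (\<lambda>n. m' n \<omega>) at_top sequentially"
        then have "\<forall>\<^sub>F n in sequentially. - Y 0 \<omega> \<le> m' n \<omega>" by (auto simp: filterlim_at_top)
        then have "\<forall>\<^sub>F n in sequentially. max (- m' n \<omega>) (Y 0 \<omega>) = Y 0 \<omega>"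
          by eventually_elim auto
        then show "(\<lambda>n. max (- m' n \<omega>) (Y 0 \<omega>)) \<longlonglongrightarrow> Y 0 \<omega>"
          by (rule tendsto_eventually)
      qed
      show "AE \<omega> in M. norm (max (- m' n \<omega>) (Y 0 \<omega>)) \<le> \<bar>Y 0 \<omega>\<bar>" for n
        by (auto intro!: AE_I2 simp: m'_def max_partial_sum_nonneg max_def abs_le_iff)
           (smt (verit) max_partial_sum_nonneg)+
    qed (use int in auto)
    then have "0 \<le> expectation (Y 0)"
      by (rule LIMSEQ_le_const) (use key in auto)
    with neg show False by simp
  qed
  with prob_bdd_above_partial_sums_0_1[OF indep] have "prob {\<omega>\<in>space M. ?b \<omega>} = 1" by simp
  then show ?thesis using b_meas by (simp add: prob_eq_1)
qed

text \<open>Subtracting \<open>expectation (Y 0) + e\<close> makes the mean negative, so the partial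
  sums are almost surely bounded by some \<open>b\<close>; after division by \<open>n\<close> the
  error \<open>b / n\<close> tends to 0.\<close>

lemma (in prob_space) AE_eventually_average_le:
  fixes Y :: "nat \<Rightarrow> 'a \<Rightarrow> real"
  assumes indep: "indep_vars (\<lambda>_. borel) Y UNIV"
    and ident: "\<And>i. distr M borel (Y i) = distr M borel (Y 0)"
    and int0: "integrable M (Y 0)"
  shows "AE \<omega> in M. \<forall>e>0. \<forall>\<^sub>F n in sequentially. (\<Sum>i<n. Y i \<omega>) / n \<le> expectation (Y 0) + e"
proof -
  have rv [measurable]: "Y i \<in> borel_measurable M" for i
    using indep by (auto simp: indep_vars_def)
  have bdd: "AE \<omega> in M. bdd_above (range (\<lambda>n. \<Sum>i<n. Y i \<omega> - expectation (Y 0) - e))" if "e > 0" for e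
  proof (rule AE_bdd_above_partial_sums)
    show "indep_vars (\<lambda>_. borel) (\<lambda>i \<omega>. Y i \<omega> - expectation (Y 0) - e) UNIV"
      using indep_vars_compose2[OF indep, of "\<lambda>_ y. y - expectation (Y 0) - e" "\<lambda>_. borel"] by simp
    show "distr M borel (\<lambda>\<omega>. Y i \<omega> - expectation (Y 0) - e) =
        distr M borel (\<lambda>\<omega>. Y 0 \<omega> - expectation (Y 0) - e)" for i
    proof -
      have "distr M borel (\<lambda>\<omega>. Y j \<omega> - expectation (Y 0) - e) =
          distr (distr M borel (Y j)) borel (\<lambda>y. y - expectation (Y 0) - e)" for j
        by (subst distr_distr) (auto simp: comp_def)
      then show ?thesis using ident[of i] by metis
    qed
  qed (use int0 that in \<open>auto simp: prob_space\<close>)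
  \<comment> \<open>Countably many levels \<open>1 / Suc k\<close> allow a single null set to serve
    all \<open>e\<close>.\<close>
  have "AE \<omega> in M. \<forall>k::nat. bdd_above (range (\<lambda>n. \<Sum>i<n. Y i \<omega> - expectation (Y 0) - 1 / Suc k))"
    unfolding AE_all_countable using bdd by simp
  then show ?thesis
  proof (rule AE_mp, intro AE_I2 impI allI)
    fix \<omega> and e :: real
    assume *: "\<forall>k::nat. bdd_above (range (\<lambda>n. \<Sum>i<n. Y i \<omega> - expectation (Y 0) - 1 / Suc k))" and "e > 0"
    obtain k where k: "1 / Suc k < e / 2"
      using \<open>e > 0\<close> nat_approx_posE[of "e / 2"] by auto
    from *[rule_format, of k] obtain b where b: "\<And>n. (\<Sum>i<n. Y i \<omega> - expectation (Y 0) - 1 / Suc k) \<le> b"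
      by (auto simp: bdd_above_def)
    have "\<forall>\<^sub>F n in sequentially. b / n < e / 2"
      by (rule order_tendstoD(2)[OF lim_const_over_n]) (use \<open>e > 0\<close> in simp)
    then show "\<forall>\<^sub>F n in sequentially. (\<Sum>i<n. Y i \<omega>) / n \<le> expectation (Y 0) + e"
      using eventually_gt_at_top[of 0]
    proof eventually_elim
      case (elim n)
      have "(\<Sum>i<n. Y i \<omega>) \<le> b + n * (expectation (Y 0) + 1 / Suc k)"
        using b[of n] by (simp add: sum_subtractf algebra_simps)
      then have "(\<Sum>i<n. Y i \<omega>) / n \<le> (b + n * (expectation (Y 0) + 1 / Suc k)) / n"
        by (rule divide_right_mono) simp
      also have "\<dots> = b / n + (expectation (Y 0) + 1 / Suc k)"
        using elim by (simp add: add_divide_distrib)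
      finally have "(\<Sum>i<n. Y i \<omega>) / n \<le> b / n + (expectation (Y 0) + 1 / Suc k)" .
      with elim k show ?case by linarith
    qed
  qed
qed

text \<open>The one-sided estimate is applied to \<open>Y\<close> and to its negative.\<close>

lemma (in prob_space) strong_law_of_large_numbers:
  fixes Y :: "nat \<Rightarrow> 'a \<Rightarrow> real"
  assumes indep: "indep_vars (\<lambda>_. borel) Y UNIV"
    and ident: "\<And>i. distr M borel (Y i) = distr M borel (Y 0)"
    and int0: "integrable M (Y 0)"
  shows "AE \<omega> in M. (\<lambda>n. (\<Sum>i<n. Y i \<omega>) / n) \<longlonglongrightarrow> expectation (Y 0)"
proof -
  have rv [measurable]: "Y i \<in> borel_measurable M" for i
    using indep by (auto simp: indep_vars_def)
  have upper: "AE \<omega> in M. \<forall>e>0. \<forall>\<^sub>F n in sequentially. (\<Sum>i<n. Y i \<omega>) / n \<le> expectation (Y 0) + e"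
    by (rule AE_eventually_average_le) fact+
  have "AE \<omega> in M. \<forall>e>0. \<forall>\<^sub>F n in sequentially. (\<Sum>i<n. - Y i \<omega>) / n \<le> expectation (\<lambda>\<omega>. - Y 0 \<omega>) + e"
  proof (rule AE_eventually_average_le)
    show "indep_vars (\<lambda>_. borel) (\<lambda>i \<omega>. - Y i \<omega>) UNIV"
      using indep_vars_compose2[OF indep, of "\<lambda>_. uminus" "\<lambda>_. borel"] by simp
    show "distr M borel (\<lambda>\<omega>. - Y i \<omega>) = distr M borel (\<lambda>\<omega>. - Y 0 \<omega>)" for i
    proof -
      have "distr M borel (\<lambda>\<omega>. - Y j \<omega>) = distr (distr M borel (Y j)) borel uminus" for j
        by (subst distr_distr) (auto simp: comp_def)
      then show ?thesis using ident[of i] by metis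
    qed
  qed (use int0 in auto)
  with upper show ?thesis
  proof eventually_elim
    case (elim \<omega>)
    show ?case
    proof (rule tendstoI)
      fix e :: real assume "e > 0"
      then have "\<forall>\<^sub>F n in sequentially. (\<Sum>i<n. Y i \<omega>) / n \<le> expectation (Y 0) + e / 2"
        "\<forall>\<^sub>F n in sequentially. (\<Sum>i<n. - Y i \<omega>) / n \<le> expectation (\<lambda>\<omega>. - Y 0 \<omega>) + e / 2"
        using elim by simp_all
      then show "\<forall>\<^sub>F n in sequentially. dist ((\<Sum>i<n. Y i \<omega>) / n) (expectation (Y 0)) < e"
      proof eventually_elim
        case (elim n)
        then show ?case using \<open>e > 0\<close> by (simp add: sum_negf dist_real_def abs_less_iff)
      qed
    qed
  qed
qed

section \<open>Conditional divergence and entropy\<close>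

text \<open>Nonnegative terms with bounded finite sums are summable. This is how a finite
  pseudo-entropy becomes integrability.\<close>

lemma integrable_measure_pmf_nonneg:
  fixes g :: "'a \<Rightarrow> real"
  assumes nonneg: "\<And>x. 0 \<le> g x"
    and bound: "\<And>A. finite A \<Longrightarrow> (\<Sum>x\<in>A. pmf p x * g x) \<le> C"
  shows "integrable (measure_pmf p) g"
proof -
  have "(\<lambda>x. pmf p x * g x) summable_on UNIV"
    by (rule nonneg_bdd_above_summable_on)
       (use nonneg bound in \<open>auto intro!: bdd_aboveI2[where M = C]\<close>)
  then have "(\<lambda>x. norm (pmf p x * g x)) summable_on UNIV"
    using nonneg by (simp add: abs_mult)
  then have "integrable (count_space UNIV) (\<lambda>x. pmf p x * g x)"
    unfolding abs_summable_equivalent abs_summable_on_def .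
  then show ?thesis
    unfolding measure_pmf_eq_density by (subst integrable_density) auto
qed

text \<open>The expectation is an unconditional sum, hence a limit of sums over finite sets. It is
  used to cut an entropy down to finitely many terms.\<close>

lemma measure_pmf_expectation_finite_approx:
  fixes g :: "'a \<Rightarrow> real"
  assumes int: "integrable (measure_pmf p) g" and "e > 0"
  obtains A where "finite A" "measure_pmf.expectation p g - e < (\<Sum>x\<in>A. pmf p x * g x)"
proof -
  have "integrable (count_space UNIV) (\<lambda>x. pmf p x * g x)"
    using int unfolding measure_pmf_eq_density by (subst (asm) integrable_density) auto
  then have abs: "(\<lambda>x. norm (pmf p x * g x)) summable_on UNIV"
    unfolding abs_summable_equivalent abs_summable_on_def .
  have "measure_pmf.expectation p g = (\<Sum>\<^sub>\<infinity>x. pmf p x * g x)"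
    unfolding pmf_expectation_eq_infsetsum using abs unfolding abs_summable_equivalent by (rule infsetsum_infsum)
  then have "((\<lambda>x. pmf p x * g x) has_sum measure_pmf.expectation p g) UNIV"
    using abs_summable_summable[OF abs] by (simp add: has_sum_infsum)
  then have "\<forall>\<^sub>F A in finite_subsets_at_top UNIV.
      (\<Sum>x\<in>A. pmf p x * g x) > measure_pmf.expectation p g - e"
    unfolding has_sum_def using \<open>e > 0\<close> by (intro order_tendstoD(1)) auto
  then obtain A where "finite A" "measure_pmf.expectation p g - e < (\<Sum>x\<in>A. pmf p x * g x)"
    by (auto simp: eventually_finite_subsets_at_top)
  then show ?thesis ..
qed

section \<open>Joint, marginal and conditional probabilities\<close>

definition joint :: "nat set \<times> nat set \<Rightarrow> ivec pmf \<Rightarrow> (ivec \<times> ivec) pmf" where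
  "joint T f = map_pmf (\<lambda>x. (restrict x (fst T), restrict x (snd T))) f"

lemma pmf_joint: "pmf (joint T f) (y, z) = \<P>(x in f. restrict x (fst T) = y \<and> restrict x (snd T) = z)"
  by (auto simp: joint_def pmf_map vimage_def)

lemma pmf_marginal: "pmf (marginal A f) z = \<P>(x in f. restrict x A = z)"
  by (auto simp: marginal_def pmf_map vimage_def)

lemma conditional_eq_divide:
  "conditional T f y z = pmf (joint T f) (y, z) / pmf (marginal (snd T) f) z"
  by (simp add: conditional_def cond_prob_def pmf_joint pmf_marginal)

lemma pmf_joint_le_marginal: "pmf (joint T f) (y, z) \<le> pmf (marginal (snd T) f) z"
  unfolding pmf_joint pmf_marginal by (intro measure_pmf.finite_measure_mono) auto

text \<open>If the conditioning event is null, the joint mass vanishes with it, so the default value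
  0 of \<open>conditional\<close> does no harm.\<close>

lemma pmf_joint_eq: "pmf (joint T f) (y, z) = pmf (marginal (snd T) f) z * conditional T f y z"
  using pmf_joint_le_marginal[of T f y z] pmf_nonneg[of "joint T f" "(y, z)"]
  by (auto simp: conditional_eq_divide)

lemma conditional_nonneg: "0 \<le> conditional T f y z"
  by (simp add: conditional_eq_divide)

lemma conditional_le_1: "conditional T f y z \<le> 1"
  using pmf_joint_le_marginal[of T f y z] by (auto simp: conditional_eq_divide divide_le_eq)

text \<open>Probability 0 is covered because \<open>ln 0 = 0\<close> for real numbers.\<close>

lemma ln_conditional_nonpos: "ln (conditional T f y z) \<le> 0"
  using conditional_nonneg[of T f y z] conditional_le_1[of T f y z]
  by (cases "conditional T f y z = 0") simp_all

lemma sum_pmf_joint_le: "finite Y \<Longrightarrow> (\<Sum>y\<in>Y. pmf (joint T f) (y, z)) \<le> pmf (marginal (snd T) f) z"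
  unfolding pmf_joint pmf_marginal
  by (subst measure_pmf.finite_measure_finite_Union[symmetric])
     (auto simp: disjoint_family_on_def intro!: measure_pmf.finite_measure_mono)

lemma sum_pmf_joint_eq:
  "finite Y \<Longrightarrow> (\<lambda>x. restrict x (fst T)) ` set_pmf f \<subseteq> Y \<Longrightarrow>
    (\<Sum>y\<in>Y. pmf (joint T f) (y, z)) = pmf (marginal (snd T) f) z"
  unfolding pmf_joint pmf_marginal
  by (subst measure_pmf.finite_measure_finite_Union[symmetric])
     (auto simp: disjoint_family_on_def AE_measure_pmf_iff image_subset_iff intro!: measure_pmf.finite_measure_eq_AE)

lemma sum_conditional_le_1: "finite Y \<Longrightarrow> (\<Sum>y\<in>Y. conditional T f y z) \<le> 1"
  using sum_pmf_joint_le[of Y T f z]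
  by (auto simp: conditional_eq_divide sum_divide_distrib[symmetric] divide_le_eq)

text \<open>A support point gives positive mass to its own pair of subvectors. This keeps the
  pseudolikelihood of \<open>f0\<close> finite on samples from its support.\<close>

lemma conditional_pos:
  assumes "x \<in> set_pmf f"
  shows "0 < conditional T f (restrict x (fst T)) (restrict x (snd T))"
proof -
  have "(restrict x (fst T), restrict x (snd T)) \<in> set_pmf (joint T f)"
    using assms by (auto simp: joint_def)
  then have "0 < pmf (joint T f) (restrict x (fst T), restrict x (snd T))"
    by (simp add: pmf_positive)
  then show ?thesis
    using pmf_joint_le_marginal[of T f "restrict x (fst T)" "restrict x (snd T)"]
    by (simp add: conditional_eq_divide)
qed

lemma expectation_joint:
  fixes g :: "ivec \<Rightarrow> ivec \<Rightarrow> real"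
  assumes "finite Y" "finite Z"
    and "(\<lambda>x. restrict x (fst T)) ` set_pmf f \<subseteq> Y" "(\<lambda>x. restrict x (snd T)) ` set_pmf f \<subseteq> Z"
  shows "measure_pmf.expectation f (\<lambda>x. g (restrict x (fst T)) (restrict x (snd T))) =
    (\<Sum>z\<in>Z. \<Sum>y\<in>Y. pmf (joint T f) (y, z) * g y z)"
proof -
  have "measure_pmf.expectation f (\<lambda>x. g (restrict x (fst T)) (restrict x (snd T))) =
      measure_pmf.expectation (joint T f) (\<lambda>(y, z). g y z)"
    by (simp add: joint_def)
  also have "\<dots> = (\<Sum>(y, z)\<in>Y \<times> Z. g y z * pmf (joint T f) (y, z))"
    using assms by (subst integral_measure_pmf_real[of "Y \<times> Z"]) (auto simp: joint_def case_prod_beta)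
  also have "\<dots> = (\<Sum>y\<in>Y. \<Sum>z\<in>Z. pmf (joint T f) (y, z) * g y z)"
    by (simp add: sum.cartesian_product mult.commute)
  also have "\<dots> = (\<Sum>z\<in>Z. \<Sum>y\<in>Y. pmf (joint T f) (y, z) * g y z)"
    by (rule sum.swap)
  finally show ?thesis .
qed

text \<open>Multiply \<open>ln (b / a) \<le> b / a - 1\<close> by \<open>- 2 * p\<close>, where
  \<open>a = sqrt p\<close> and \<open>b = sqrt q\<close>. The correction \<open>p - q\<close> is
  harmless after summation over a distribution \<open>p\<close> and a subdistribution
  \<open>q\<close>.\<close>

lemma mult_ln_diff_ge_sqrt_diff:
  fixes p q :: real
  assumes "0 \<le> p" "0 \<le> q" "0 < p \<Longrightarrow> 0 < q"
  shows "(sqrt p - sqrt q)\<^sup>2 + p - q \<le> p * (ln p - ln q)"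
proof (cases "p = 0")
  case False
  with assms have pos: "0 < p" "0 < q" by auto
  define a b where "a = sqrt p" and "b = sqrt q"
  have ab: "0 < a" "0 < b" "p = a\<^sup>2" "q = b\<^sup>2" using pos by (auto simp: a_def b_def)
  have "ln (b / a) \<le> b / a - 1" using ab by (intro ln_le_minus_one) auto
  then have "a * a * (ln b - ln a) \<le> a * a * (b / a - 1)"
    using ab by (intro mult_left_mono) (auto simp: ln_div)
  also have "a * a * (b / a - 1) = a * b - a * a" using ab by (simp add: field_simps)
  finally have "a * a * (ln b - ln a) \<le> a * b - a * a" .
  then show ?thesis
    using ab by (simp add: ln_realpow a_def[symmetric] b_def[symmetric] power2_eq_square algebra_simps ln_mult)
qed (use assms in simp)

text \<open>Sum the preceding inequality over the left values for each right value: the conditional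
  probabilities under \<open>p\<close> add up to 1 and those under \<open>f\<close> to at most 1, so
  the corrections have nonnegative total. Of the squared Hellinger sum only the term at
  \<open>y\<close> and \<open>z\<close> is kept.\<close>

lemma divergence_ge_sqrt_diff:
  assumes fin: "finite (set_pmf p)"
    and pos: "\<And>x. x \<in> set_pmf p \<Longrightarrow> 0 < conditional T f (restrict x (fst T)) (restrict x (snd T))"
  shows "pmf (marginal (snd T) p) z * (sqrt (conditional T p y z) - sqrt (conditional T f y z))\<^sup>2 \<le>
    measure_pmf.expectation p (\<lambda>x.
      ln (conditional T p (restrict x (fst T)) (restrict x (snd T))) -
      ln (conditional T f (restrict x (fst T)) (restrict x (snd T))))"
proof -
  \<comment> \<open>The given \<open>y\<close> and \<open>z\<close> may lie outside the support of
    \<open>p\<close>, hence the insertions.\<close>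
  define Y where "Y = insert y ((\<lambda>x. restrict x (fst T)) ` set_pmf p)"
  define Z where "Z = insert z ((\<lambda>x. restrict x (snd T)) ` set_pmf p)"
  let ?r = "\<lambda>z. pmf (marginal (snd T) p) z"
  let ?s = "\<lambda>y z. (sqrt (conditional T p y z) - sqrt (conditional T f y z))\<^sup>2"
  let ?k = "\<lambda>y z. ln (conditional T p y z) - ln (conditional T f y z)"
  have Y: "finite Y" "y \<in> Y" "(\<lambda>x. restrict x (fst T)) ` set_pmf p \<subseteq> Y"
    and Z: "finite Z" "z \<in> Z" "(\<lambda>x. restrict x (snd T)) ` set_pmf p \<subseteq> Z"
    using fin by (auto simp: Y_def Z_def)
  \<comment> \<open>A pair of positive probability under \<open>p\<close> stems from a support
    point, where \<open>pos\<close> applies.\<close>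
  have cpos: "0 < conditional T f b a" if "0 < conditional T p b a" for a b
  proof -
    have "pmf (joint T p) (b, a) \<noteq> 0" using that by (auto simp: conditional_eq_divide)
    then have "(b, a) \<in> set_pmf (joint T p)" by (simp add: set_pmf_iff)
    then show ?thesis using pos by (auto simp: joint_def)
  qed
  have inner: "?r a * (\<Sum>b\<in>Y. ?s b a) \<le> (\<Sum>b\<in>Y. pmf (joint T p) (b, a) * ?k b a)" for a
  proof (cases "?r a = 0")
    case True
    then show ?thesis by (simp add: pmf_joint_eq)
  next
    case False
    have "(\<Sum>b\<in>Y. conditional T p b a) = 1"
      using sum_pmf_joint_eq[OF Y(1,3), of a] False
      by (simp add: conditional_eq_divide sum_divide_distrib[symmetric])
    then have "(\<Sum>b\<in>Y. ?s b a) \<le> (\<Sum>b\<in>Y. ?s b a + conditional T p b a - conditional T f b a)"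
      using sum_conditional_le_1[OF Y(1), of T f a] by (simp add: sum.distrib sum_subtractf)
    also have "\<dots> \<le> (\<Sum>b\<in>Y. conditional T p b a * ?k b a)"
      using cpos by (intro sum_mono mult_ln_diff_ge_sqrt_diff conditional_nonneg)
    finally have "?r a * (\<Sum>b\<in>Y. ?s b a) \<le> ?r a * (\<Sum>b\<in>Y. conditional T p b a * ?k b a)"
      by (rule mult_left_mono) simp
    then show ?thesis by (simp add: pmf_joint_eq sum_distrib_left mult.assoc)
  qed
  have "?r z * ?s y z \<le> ?r z * (\<Sum>b\<in>Y. ?s b z)"
    using Y by (intro mult_left_mono member_le_sum) auto
  also have "\<dots> \<le> (\<Sum>a\<in>Z. ?r a * (\<Sum>b\<in>Y. ?s b a))"
    using Z by (intro member_le_sum) (auto intro!: mult_nonneg_nonneg sum_nonneg)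
  also have "\<dots> \<le> (\<Sum>a\<in>Z. \<Sum>b\<in>Y. pmf (joint T p) (b, a) * ?k b a)"
    by (intro sum_mono inner)
  also have "\<dots> = measure_pmf.expectation p (\<lambda>x. ?k (restrict x (fst T)) (restrict x (snd T)))"
    using Y Z by (intro expectation_joint[symmetric]) auto
  finally show ?thesis .
qed

text \<open>The expectation of the logarithm is minus the entropy, hence the upper bound. Entropy
  terms are nonnegative, so finitely many of them, carrying the entropy of \<open>f\<close> up to
  \<open>e\<close>, bound the entropy of \<open>p n\<close> from below once they have
  converged.\<close>

lemma conditional_entropy_lower_semicontinuous:
  assumes fin: "\<And>n. finite (set_pmf (p n))"
    and joint: "\<And>y z. (\<lambda>n. pmf (joint T (p n)) (y, z)) \<longlonglongrightarrow> pmf (joint T f) (y, z)"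
    and marg: "\<And>z. (\<lambda>n. pmf (marginal (snd T) (p n)) z) \<longlonglongrightarrow> pmf (marginal (snd T) f) z"
    and int: "integrable (measure_pmf f) (\<lambda>x. ln (conditional T f (restrict x (fst T)) (restrict x (snd T))))"
    and "e > 0"
  shows "\<forall>\<^sub>F n in sequentially.
    measure_pmf.expectation (p n) (\<lambda>x. ln (conditional T (p n) (restrict x (fst T)) (restrict x (snd T)))) \<le>
    measure_pmf.expectation f (\<lambda>x. ln (conditional T f (restrict x (fst T)) (restrict x (snd T)))) + e"
    (is "\<forall>\<^sub>F n in _. ?E n \<le> ?H + e")
proof -
  let ?h = "\<lambda>g (y, z). - ln (conditional T g y z)"
  have E0: "measure_pmf.expectation (joint T f) (?h f) = - ?H"
    by (simp add: joint_def)
  have E: "measure_pmf.expectation (joint T (p n)) (?h (p n)) = - ?E n" for n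
    by (simp add: joint_def)
  have "integrable (measure_pmf (joint T f)) (?h f)"
    using int by (simp add: joint_def)
  then obtain A where A: "finite A" "- ?H - e < (\<Sum>x\<in>A. pmf (joint T f) x * ?h f x)"
    using measure_pmf_expectation_finite_approx[OF _ \<open>e > 0\<close>] unfolding E0[symmetric] by blast
  \<comment> \<open>On the support the limiting conditional probability is positive, so
    \<open>ln\<close> is continuous there.\<close>
  let ?B = "A \<inter> set_pmf (joint T f)"
  have "(\<Sum>x\<in>A. pmf (joint T f) x * ?h f x) = (\<Sum>x\<in>?B. pmf (joint T f) x * ?h f x)"
    using A by (intro sum.mono_neutral_right) (auto simp: set_pmf_iff)
  moreover have "(\<lambda>n. \<Sum>x\<in>?B. pmf (joint T (p n)) x * ?h (p n) x) \<longlonglongrightarrow> (\<Sum>x\<in>?B. pmf (joint T f) x * ?h f x)"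
  proof (rule tendsto_sum)
    fix x assume x: "x \<in> ?B"
    obtain y z where [simp]: "x = (y, z)" by (cases x)
    have "pmf (joint T f) (y, z) > 0" using x by (simp add: pmf_positive)
    then show "(\<lambda>n. pmf (joint T (p n)) x * ?h (p n) x) \<longlonglongrightarrow> pmf (joint T f) x * ?h f x"
      using pmf_joint_le_marginal[of T f y z]
      by (auto simp: conditional_eq_divide intro!: tendsto_intros joint marg)
  qed
  ultimately have "\<forall>\<^sub>F n in sequentially. - ?H - e < (\<Sum>x\<in>?B. pmf (joint T (p n)) x * ?h (p n) x)"
    using A(2) by (intro order_tendstoD(1)) auto
  then show ?thesis
  proof eventually_elim
    case (elim n)
    \<comment> \<open>Enlarging \<open>?B\<close> to cover the support of
      \<open>joint T (p n)\<close> only adds nonnegative terms.\<close>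
    let ?C = "?B \<union> set_pmf (joint T (p n))"
    have C: "finite ?C" using A fin by (auto simp: joint_def)
    have "(\<Sum>x\<in>?B. pmf (joint T (p n)) x * ?h (p n) x) \<le> (\<Sum>x\<in>?C. pmf (joint T (p n)) x * ?h (p n) x)"
      using C by (intro sum_mono2) (auto intro!: mult_nonneg_nonneg simp: ln_conditional_nonpos)
    also have "\<dots> = measure_pmf.expectation (joint T (p n)) (?h (p n))"
      using C by (subst integral_measure_pmf_real[of ?C]) (auto simp: mult.commute)
    finally show ?case using elim unfolding E by simp
  qed
qed

section \<open>Pseudolikelihood and pseudo-entropy\<close>

text \<open>
  A marginal is treated as a conditional distribution given the empty set of coordinates: the set
  \<open>S\<close> becomes the pair \<open>(S, {})\<close>, and the only value of the empty subvector is \<open>\<lambda>_. undefined\<close>.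
\<close>

definition blocks :: "nat \<Rightarrow> (nat set \<times> nat set) set" where
  "blocks q = (\<lambda>S. (S, {})) ` nonempty_subsets q \<union> bipartitions q"

definition weight ::
  "(nat set \<Rightarrow> real) \<Rightarrow> (nat set \<times> nat set \<Rightarrow> real) \<Rightarrow> nat set \<times> nat set \<Rightarrow> real"
where
  "weight c d T = (if snd T = {} then c (fst T) else d T)"

definition cond_at :: "nat set \<times> nat set \<Rightarrow> ivec pmf \<Rightarrow> ivec \<Rightarrow> real" where
  "cond_at T f x = conditional T f (restrict x (fst T)) (restrict x (snd T))"

lemma finite_nonempty_subsets: "finite (nonempty_subsets q)"
  by (rule finite_subset[of _ "Pow {1..q}"]) (auto simp: nonempty_subsets_def)

lemma finite_bipartitions: "finite (bipartitions q)"
proof (rule finite_subset)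
  show "bipartitions q \<subseteq> Pow {1..q} \<times> Pow {1..q}" by (auto simp: bipartitions_def)
qed simp

lemma finite_blocks: "finite (blocks q)"
  by (simp add: blocks_def finite_nonempty_subsets finite_bipartitions)

lemma marginal_empty: "marginal {} f = return_pmf (\<lambda>_. undefined)"
  by (simp add: marginal_def restrict_def map_pmf_const)

lemma conditional_empty: "conditional (S, {}) f y (\<lambda>_. undefined) = pmf (marginal S f) y"
  by (simp add: conditional_eq_divide marginal_empty pmf_joint pmf_marginal restrict_def)

lemma cond_at_empty: "cond_at (S, {}) f x = pmf (marginal S f) (restrict x S)"
  using conditional_empty[of S f "restrict x S"] by (simp add: cond_at_def restrict_def)

text \<open>The pairs \<open>(S, {})\<close> are never bipartitions, whose right sets are non-empty,
  so the two sums combine over a disjoint union.\<close>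

lemma log_pseudolikelihood_eq:
  "log_pseudolikelihood q c d n x f =
    (\<Sum>i\<in>{1..n}. \<Sum>T\<in>blocks q. ereal (weight c d T) * log_prob (cond_at T f (x i)))"
proof -
  have "(\<Sum>T\<in>blocks q. ereal (weight c d T) * log_prob (cond_at T f u)) =
     (\<Sum>S\<in>nonempty_subsets q. ereal (c S) * log_prob (pmf (marginal S f) (restrict u S))) +
     (\<Sum>T\<in>bipartitions q. ereal (d T) * log_prob (cond_at T f u))" for u
  proof -
    have "(\<Sum>T\<in>blocks q. ereal (weight c d T) * log_prob (cond_at T f u)) =
      (\<Sum>T\<in>(\<lambda>S. (S, {})) ` nonempty_subsets q. ereal (weight c d T) * log_prob (cond_at T f u)) +
      (\<Sum>T\<in>bipartitions q. ereal (weight c d T) * log_prob (cond_at T f u))"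
      unfolding blocks_def
    proof (rule sum.union_disjoint)
      show "(\<lambda>S. (S, {})) ` nonempty_subsets q \<inter> bipartitions q = {}" by (auto simp: bipartitions_def)
    qed (simp_all add: finite_nonempty_subsets finite_bipartitions)
    moreover have "(\<Sum>T\<in>bipartitions q. ereal (weight c d T) * log_prob (cond_at T f u)) =
        (\<Sum>T\<in>bipartitions q. ereal (d T) * log_prob (cond_at T f u))"
      by (rule sum.cong) (auto simp: weight_def bipartitions_def)
    ultimately show ?thesis
      by (simp add: sum.reindex inj_on_def cond_at_empty weight_def)
  qed
  then show ?thesis
    by (simp add: log_pseudolikelihood_def sum.distrib[symmetric] cond_at_def)
qed

lemma log_pseudolikelihood_finite:
  assumes "\<And>i T. i \<in> {1..n} \<Longrightarrow> T \<in> blocks q \<Longrightarrow> weight c d T \<noteq> 0 \<Longrightarrow> 0 < cond_at T f (x i)"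
  shows "log_pseudolikelihood q c d n x f =
    ereal (\<Sum>i\<in>{1..n}. \<Sum>T\<in>blocks q. weight c d T * ln (cond_at T f (x i)))"
proof -
  have "ereal (weight c d T) * log_prob (cond_at T f (x i)) = ereal (weight c d T * ln (cond_at T f (x i)))"
    if "i \<in> {1..n}" "T \<in> blocks q" for i T
    using assms[OF that] by (cases "weight c d T = 0") (auto simp: log_prob_def zero_ereal_def[symmetric])
  then show ?thesis by (simp add: log_pseudolikelihood_eq)
qed

text \<open>Nonpositivity keeps the other summands away from \<open>\<infinity>\<close>, which would
  absorb \<open>-\<infinity>\<close> in \<open>ereal\<close>.\<close>

lemma ereal_sum_nonpos_eq_MInf:
  fixes g :: "'b \<Rightarrow> ereal"
  assumes "finite A" "\<And>x. x \<in> A \<Longrightarrow> g x \<le> 0" "a \<in> A" "g a = -\<infinity>"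
  shows "sum g A = -\<infinity>"
proof -
  have "sum g (A - {a}) \<le> 0" using assms by (intro sum_nonpos) auto
  then show ?thesis
    using assms by (subst sum.remove[of _ a]) auto
qed

text \<open>All terms are nonpositive, so a single zero probability of positive weight would force
  the whole sum to \<open>-\<infinity>\<close>. This is applied to the maximizer.\<close>

lemma cond_at_pos_of_log_pseudolikelihood:
  assumes weight: "\<And>T. T \<in> blocks q \<Longrightarrow> 0 \<le> weight c d T"
    and fin: "log_pseudolikelihood q c d n x f \<noteq> -\<infinity>"
    and "i \<in> {1..n}" "T \<in> blocks q" "weight c d T \<noteq> 0"
  shows "0 < cond_at T f (x i)"
proof (rule ccontr)
  let ?t = "\<lambda>i T. ereal (weight c d T) * log_prob (cond_at T f (x i))"
  have "log_prob (cond_at T f (x i)) \<le> 0" for T i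
    using conditional_le_1[of T f] by (auto simp: log_prob_def cond_at_def)
  then have nonpos: "?t i T \<le> 0" if "T \<in> blocks q" for i T
    using weight[OF that] by (auto simp: ereal_mult_le_0_iff)
  assume "\<not> 0 < cond_at T f (x i)"
  then have "?t i T = -\<infinity>"
    using weight[OF \<open>T \<in> blocks q\<close>] \<open>weight c d T \<noteq> 0\<close> by (auto simp: log_prob_def)
  then have "(\<Sum>T\<in>blocks q. ?t i T) = -\<infinity>"
    using nonpos \<open>T \<in> blocks q\<close> by (intro ereal_sum_nonpos_eq_MInf[where a = T]) (auto simp: finite_blocks)
  then have "(\<Sum>i\<in>{1..n}. \<Sum>T\<in>blocks q. ?t i T) = -\<infinity>"
    using nonpos \<open>i \<in> {1..n}\<close>
    by (intro ereal_sum_nonpos_eq_MInf[where a = i]) (auto intro!: sum_nonpos)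
  with fin show False by (simp add: log_pseudolikelihood_eq)
qed

section \<open>Integrability of log-probabilities from finite pseudo-entropy\<close>

lemma sum_le_enn2real_infsum:
  fixes g :: "'b \<Rightarrow> real"
  assumes "\<And>x. x \<in> B \<Longrightarrow> 0 \<le> g x" and "finite A" "A \<subseteq> B" and fin: "(\<Sum>\<^sub>\<infinity>x\<in>B. ennreal (g x)) < \<infinity>"
  shows "sum g A \<le> enn2real (\<Sum>\<^sub>\<infinity>x\<in>B. ennreal (g x))"
proof -
  have "ennreal (sum g A) = (\<Sum>x\<in>A. ennreal (g x))"
    using assms by (subst sum_ennreal) auto
  also have "\<dots> \<le> (\<Sum>\<^sub>\<infinity>x\<in>B. ennreal (g x))"
    using assms by (subst nonneg_infsum_complete) (auto intro!: SUP_upper)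
  finally have "enn2real (ennreal (sum g A)) \<le> enn2real (\<Sum>\<^sub>\<infinity>x\<in>B. ennreal (g x))"
    using fin by (intro enn2real_mono) auto
  moreover have "0 \<le> sum g A" using assms by (intro sum_nonneg) auto
  ultimately show ?thesis by simp
qed

lemma sum_sum_le_enn2real_infsum:
  fixes g :: "'b \<Rightarrow> 'd \<Rightarrow> real"
  assumes nonneg: "\<And>x y. 0 \<le> g x y"
    and "finite A" "A \<subseteq> A'" "finite B" "B \<subseteq> B'"
    and fin: "(\<Sum>\<^sub>\<infinity>x\<in>A'. \<Sum>\<^sub>\<infinity>y\<in>B'. ennreal (g x y)) < \<infinity>"
  shows "(\<Sum>x\<in>A. \<Sum>y\<in>B. g x y) \<le> enn2real (\<Sum>\<^sub>\<infinity>x\<in>A'. \<Sum>\<^sub>\<infinity>y\<in>B'. ennreal (g x y))"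
proof -
  have "ennreal (\<Sum>x\<in>A. \<Sum>y\<in>B. g x y) = (\<Sum>x\<in>A. \<Sum>y\<in>B. ennreal (g x y))"
    using nonneg by (simp add: sum_ennreal sum_nonneg)
  also have "\<dots> \<le> (\<Sum>x\<in>A. \<Sum>\<^sub>\<infinity>y\<in>B'. ennreal (g x y))"
    using assms by (intro sum_mono, subst nonneg_infsum_complete) (auto intro!: SUP_upper)
  also have "\<dots> \<le> (\<Sum>\<^sub>\<infinity>x\<in>A'. \<Sum>\<^sub>\<infinity>y\<in>B'. ennreal (g x y))"
    using assms by (subst (2) nonneg_infsum_complete) (auto intro!: SUP_upper)
  finally have "enn2real (ennreal (\<Sum>x\<in>A. \<Sum>y\<in>B. g x y)) \<le>
      enn2real (\<Sum>\<^sub>\<infinity>x\<in>A'. \<Sum>\<^sub>\<infinity>y\<in>B'. ennreal (g x y))"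
    using fin by (intro enn2real_mono) auto
  then show ?thesis using nonneg by (simp add: sum_nonneg)
qed

text \<open>The expectation of minus the log-marginal is the entropy of the marginal, that is, the
  \<open>S\<close>-term of the pseudo-entropy divided by \<open>c S\<close>.\<close>

lemma integrable_ln_cond_at_marginal:
  assumes supp: "set_pmf f \<subseteq> \<X>" and "0 < c S"
    and fin: "(\<Sum>\<^sub>\<infinity>x\<in>subvectors \<X> S. ennreal (- (c S * (pmf (marginal S f) x * ln (pmf (marginal S f) x))))) < \<infinity>"
  shows "integrable (measure_pmf f) (\<lambda>x. ln (cond_at (S, {}) f x))"
proof -
  let ?g = "\<lambda>y. - ln (pmf (marginal S f) y)"
  have g: "0 \<le> ?g y" for y
    using ln_conditional_nonpos[of "(S, {})" f y "\<lambda>_. undefined"] by (simp add: conditional_empty)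
  have "integrable (marginal S f) ?g"
  proof (rule integrable_measure_pmf_nonneg)
    let ?C = "enn2real (\<Sum>\<^sub>\<infinity>x\<in>subvectors \<X> S. ennreal (- (c S * (pmf (marginal S f) x * ln (pmf (marginal S f) x))))) / c S"
    fix A :: "ivec set" assume "finite A"
    have "(\<Sum>y\<in>A. pmf (marginal S f) y * ?g y) = (\<Sum>y\<in>A \<inter> subvectors \<X> S. pmf (marginal S f) y * ?g y)"
      using \<open>finite A\<close> supp
      by (intro sum.mono_neutral_right) (auto simp: subvectors_def marginal_def pmf_eq_0_set_pmf)
    moreover have "c S * (\<Sum>y\<in>A \<inter> subvectors \<X> S. pmf (marginal S f) y * ?g y) =
        (\<Sum>y\<in>A \<inter> subvectors \<X> S. - (c S * (pmf (marginal S f) y * ln (pmf (marginal S f) y))))"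
      by (simp add: sum_distrib_left)
    moreover have "\<dots> \<le> enn2real (\<Sum>\<^sub>\<infinity>x\<in>subvectors \<X> S. ennreal (- (c S * (pmf (marginal S f) x * ln (pmf (marginal S f) x)))))"
      using \<open>finite A\<close> \<open>0 < c S\<close> g fin
      by (intro sum_le_enn2real_infsum) (auto simp: mult_le_0_iff)
    ultimately show "(\<Sum>y\<in>A. pmf (marginal S f) y * ?g y) \<le> ?C"
      using \<open>0 < c S\<close> by (simp add: le_divide_eq mult.commute)
  qed (rule g)
  then show ?thesis
    by (simp add: marginal_def cond_at_empty)
qed

text \<open>A joint probability is at most the conditional one, so the unweighted sum in the
  pseudo-entropy dominates the expectation of \<open>- ln (cond_at T f x)\<close>.\<close>

lemma integrable_ln_cond_at_conditional:
  assumes supp: "set_pmf f \<subseteq> \<X>"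
    and fin: "(\<Sum>\<^sub>\<infinity>z\<in>subvectors \<X> (snd T). \<Sum>\<^sub>\<infinity>y\<in>subvectors \<X> (fst T).
      ennreal (- (conditional T f y z * ln (conditional T f y z)))) < \<infinity>"
  shows "integrable (measure_pmf f) (\<lambda>x. ln (cond_at T f x))"
proof -
  let ?g = "\<lambda>(y, z). - ln (conditional T f y z)"
  let ?h = "\<lambda>z y. - (conditional T f y z * ln (conditional T f y z))"
  have "integrable (joint T f) ?g"
  proof (rule integrable_measure_pmf_nonneg)
    let ?C = "enn2real (\<Sum>\<^sub>\<infinity>z\<in>subvectors \<X> (snd T). \<Sum>\<^sub>\<infinity>y\<in>subvectors \<X> (fst T). ennreal (?h z y))"
    fix A :: "(ivec \<times> ivec) set" assume "finite A"
    \<comment> \<open>The iterated sum requires a rectangle; this one contains all support points in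
      \<open>A\<close>.\<close>
    define Y where "Y = fst ` A \<inter> subvectors \<X> (fst T)"
    define Z where "Z = snd ` A \<inter> subvectors \<X> (snd T)"
    have YZ: "finite Y" "Y \<subseteq> subvectors \<X> (fst T)" "finite Z" "Z \<subseteq> subvectors \<X> (snd T)"
      using \<open>finite A\<close> by (auto simp: Y_def Z_def)
    have h: "0 \<le> ?h z y" for y z
      using conditional_nonneg[of T f y z] ln_conditional_nonpos[of T f y z] by (simp add: mult_le_0_iff)
    have "(\<Sum>x\<in>A. pmf (joint T f) x * ?g x) \<le> (\<Sum>x\<in>Y \<times> Z. pmf (joint T f) x * ?g x)"
    proof -
      have "(\<Sum>x\<in>A. pmf (joint T f) x * ?g x) = (\<Sum>x\<in>A \<inter> set_pmf (joint T f). pmf (joint T f) x * ?g x)"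
        using \<open>finite A\<close> by (intro sum.mono_neutral_right) (auto simp: set_pmf_iff)
      also have "\<dots> \<le> (\<Sum>x\<in>Y \<times> Z. pmf (joint T f) x * ?g x)"
      proof (rule sum_mono2)
        show "A \<inter> set_pmf (joint T f) \<subseteq> Y \<times> Z"
          using supp by (force simp: Y_def Z_def joint_def subvectors_def)
      qed (use YZ in \<open>auto simp: mult_le_0_iff ln_conditional_nonpos\<close>)
      finally show ?thesis .
    qed
    also have "\<dots> \<le> (\<Sum>x\<in>Y \<times> Z. ?h (snd x) (fst x))"
    proof (rule sum_mono, clarify)
      fix y z
      have "pmf (joint T f) (y, z) \<le> conditional T f y z"
        unfolding pmf_joint_eq using conditional_nonneg pmf_le_1 by (rule mult_left_le_one_le[OF _ pmf_nonneg])
      then show "pmf (joint T f) (y, z) * - ln (conditional T f y z) \<le> ?h (snd (y, z)) (fst (y, z))"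
        using ln_conditional_nonpos[of T f y z] by (simp add: mult_right_mono_neg)
    qed
    also have "\<dots> = (\<Sum>z\<in>Z. \<Sum>y\<in>Y. ?h z y)"
      by (subst sum.swap) (simp add: sum.cartesian_product case_prod_beta)
    also have "\<dots> \<le> ?C"
      using h YZ fin by (intro sum_sum_le_enn2real_infsum) auto
    finally show "(\<Sum>x\<in>A. pmf (joint T f) x * ?g x) \<le> ?C" .
  qed (auto simp: ln_conditional_nonpos)
  then show ?thesis
    by (simp add: joint_def cond_at_def)
qed

lemma integrable_ln_cond_at:
  assumes supp: "set_pmf f \<subseteq> \<X>" and fin: "pseudo_entropy q \<X> c d f < \<infinity>"
    and c: "\<And>S. S \<in> nonempty_subsets q \<Longrightarrow> c S \<ge> 0"
    and d: "\<And>T. T \<in> bipartitions q \<Longrightarrow> d T \<ge> 0"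
    and T: "T \<in> blocks q" "weight c d T \<noteq> 0"
  shows "integrable (measure_pmf f) (\<lambda>x. ln (cond_at T f x))"
proof -
  let ?a = "\<lambda>S. \<Sum>\<^sub>\<infinity>x\<in>subvectors \<X> S. ennreal (- (c S * (pmf (marginal S f) x * ln (pmf (marginal S f) x))))"
  let ?b = "\<lambda>T. ennreal (d T) * (\<Sum>\<^sub>\<infinity>z\<in>subvectors \<X> (snd T). \<Sum>\<^sub>\<infinity>y\<in>subvectors \<X> (fst T).
           ennreal (- (conditional T f y z * ln (conditional T f y z))))"
  have fin': "(\<Sum>S\<in>nonempty_subsets q. ?a S) < \<infinity>" "(\<Sum>T\<in>bipartitions q. ?b T) < \<infinity>"
    using fin unfolding pseudo_entropy_def by (auto simp: less_top[symmetric])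
  from T(1) consider S where "S \<in> nonempty_subsets q" "T = (S, {})" | "T \<in> bipartitions q"
    by (auto simp: blocks_def)
  then show ?thesis
  proof cases
    case 1
    have "?a S \<le> (\<Sum>S\<in>nonempty_subsets q. ?a S)"
      using 1 by (intro member_le_sum) (auto simp: finite_nonempty_subsets)
    then show ?thesis
      using 1 T(2) c[of S] supp fin'(1)
      by (auto simp: weight_def intro!: integrable_ln_cond_at_marginal[of f \<X> c S])
  next
    case 2
    have "?b T \<le> (\<Sum>T\<in>bipartitions q. ?b T)"
      using 2 by (intro member_le_sum) (auto simp: finite_bipartitions)
    then have "?b T < \<infinity>" using fin'(2) by (rule le_less_trans)
    moreover have "snd T \<noteq> {}" using 2 by (auto simp: bipartitions_def)
    \<comment> \<open>A positive weight is essential here: \<open>0 * \<infinity> = 0\<close> would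
      make the product finite whatever the inner sum is.\<close>
    then have "0 < d T" using 2 T(2) d[of T] by (simp add: weight_def)
    ultimately show ?thesis
      using supp by (intro integrable_ln_cond_at_conditional[of f \<X>])
        (auto simp: less_top[symmetric] ennreal_mult_eq_top_iff)
  qed
qed

section \<open>Consistency\<close>

text \<open>This is the deterministic core, for one fixed sample path: \<open>P n\<close> is the
  empirical distribution and \<open>F n\<close> the estimator. The assumption \<open>max\<close>
  compares total divergences, and nonnegativity of each divergence isolates the one for
  \<open>T\<close>.\<close>

lemma conditional_tendsto:
  fixes P F :: "nat \<Rightarrow> ivec pmf"
  assumes "finite K" and w: "\<And>T. T \<in> K \<Longrightarrow> 0 < w T"
    and fin: "\<And>n. finite (set_pmf (P n))"
    and joint: "\<And>T y z. T \<in> K \<Longrightarrow> (\<lambda>n. pmf (joint T (P n)) (y, z)) \<longlonglongrightarrow> pmf (joint T f0) (y, z)"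
    and marg: "\<And>T z. T \<in> K \<Longrightarrow> (\<lambda>n. pmf (marginal (snd T) (P n)) z) \<longlonglongrightarrow> pmf (marginal (snd T) f0) z"
    and int: "\<And>T. T \<in> K \<Longrightarrow> integrable (measure_pmf f0) (\<lambda>x. ln (cond_at T f0 x))"
    and ent: "\<And>T. T \<in> K \<Longrightarrow> (\<lambda>n. measure_pmf.expectation (P n) (\<lambda>x. ln (cond_at T f0 x)))
      \<longlonglongrightarrow> measure_pmf.expectation f0 (\<lambda>x. ln (cond_at T f0 x))"
    and pos: "\<And>n T x. T \<in> K \<Longrightarrow> x \<in> set_pmf (P n) \<Longrightarrow> 0 < cond_at T (F n) x"
    and max: "\<And>n. (\<Sum>T\<in>K. w T * measure_pmf.expectation (P n) (\<lambda>x. ln (cond_at T f0 x))) \<le>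
      (\<Sum>T\<in>K. w T * measure_pmf.expectation (P n) (\<lambda>x. ln (cond_at T (F n) x)))"
    and T: "T \<in> K" and z: "0 < pmf (marginal (snd T) f0) z"
  shows "(\<lambda>n. conditional T (F n) y z) \<longlonglongrightarrow> conditional T f0 y z"
    and "\<forall>\<^sub>F n in sequentially. 0 < pmf (marginal (snd T) (F n)) z"
proof -
  have [simp]: "integrable (measure_pmf (P n)) g" for n and g :: "ivec \<Rightarrow> real"
    using fin by (rule integrable_measure_pmf_finite)
  let ?E = "\<lambda>n f T. measure_pmf.expectation (P n) (\<lambda>x. ln (cond_at T f x))"
  define D where "D n T = ?E n (P n) T - ?E n (F n) T" for n T
  have D_ge: "pmf (marginal (snd T) (P n)) z * (sqrt (conditional T (P n) y z) - sqrt (conditional T (F n) y z))\<^sup>2 \<le> D n T"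
    if "T \<in> K" for n T y z
    using divergence_ge_sqrt_diff[OF fin, of n T "F n" z y] pos[OF that]
    by (simp add: D_def cond_at_def)
  have D_nonneg: "0 \<le> D n T" if "T \<in> K" for n T
    by (rule order_trans[OF _ D_ge[OF that]]) simp
  \<comment> \<open>Semicontinuity bounds the first term above by the limit that \<open>ent\<close>
    gives for the second.\<close>
  have ev: "\<forall>\<^sub>F n in sequentially. ?E n (P n) T - ?E n f0 T < e" if "T \<in> K" "e > 0" for T e
  proof -
    have "\<forall>\<^sub>F n in sequentially. ?E n (P n) T \<le> measure_pmf.expectation f0 (\<lambda>x. ln (cond_at T f0 x)) + e / 2"
      unfolding cond_at_def
      by (rule conditional_entropy_lower_semicontinuous)
         (use that fin joint marg int in \<open>auto simp: cond_at_def\<close>)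
    moreover have "\<forall>\<^sub>F n in sequentially. measure_pmf.expectation f0 (\<lambda>x. ln (cond_at T f0 x)) - e / 2 < ?E n f0 T"
      using that by (intro order_tendstoD(1)[OF ent]) auto
    ultimately show ?thesis by eventually_elim linarith
  qed
  have D_lim: "(\<lambda>n. D n T) \<longlonglongrightarrow> 0"
  proof (rule tendstoI)
    fix e :: real assume "e > 0"
    define W where "W = sum w K"
    have "0 < W" unfolding W_def using \<open>finite K\<close> T w by (intro sum_pos) auto
    \<comment> \<open>Chosen so that the total bound \<open>W * e'\<close> equals
      \<open>w T * e\<close>.\<close>
    define e' where "e' = e * w T / W"
    have "0 < e'" using \<open>e > 0\<close> \<open>0 < W\<close> w[OF T] by (simp add: e'_def)
    then have "\<forall>\<^sub>F n in sequentially. \<forall>T\<in>K. ?E n (P n) T - ?E n f0 T < e'"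
      using ev \<open>finite K\<close> by (intro eventually_ball_finite) auto
    then show "\<forall>\<^sub>F n in sequentially. dist (D n T) 0 < e"
    proof eventually_elim
      case (elim n)
      have "w T * D n T \<le> (\<Sum>T\<in>K. w T * D n T)"
        using \<open>finite K\<close> T w D_nonneg by (intro member_le_sum) (auto simp: less_imp_le)
      also have "\<dots> \<le> (\<Sum>T\<in>K. w T * (?E n (P n) T - ?E n f0 T))"
        using max[of n] by (simp add: D_def right_diff_distrib sum_subtractf)
      also have "\<dots> < (\<Sum>T\<in>K. w T * e')"
        using elim w T \<open>finite K\<close> by (intro sum_strict_mono) auto
      also have "\<dots> = W * e'" by (simp add: sum_distrib_right W_def)
      also have "\<dots> = w T * e" using \<open>0 < W\<close> by (simp add: e'_def)
      finally have "D n T < e" using w[OF T] by simp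
      then show ?case using D_nonneg[OF T, of n] by simp
    qed
  qed
  have pz: "\<forall>\<^sub>F n in sequentially. 0 < pmf (marginal (snd T) (P n)) z"
    using order_tendstoD(1)[OF marg[OF T] z] .
  have cP: "(\<lambda>n. conditional T (P n) y z) \<longlonglongrightarrow> conditional T f0 y z"
    unfolding conditional_eq_divide using z by (intro tendsto_divide joint marg T) auto
  \<comment> \<open>The weight of \<open>z\<close> in \<open>D_ge\<close> tends to a positive limit,
    so it can be divided out.\<close>
  have "(\<lambda>n. (sqrt (conditional T (P n) y z) - sqrt (conditional T (F n) y z))\<^sup>2) \<longlonglongrightarrow> 0"
  proof (rule tendsto_sandwich[OF _ _ tendsto_const])
    show "(\<lambda>n. D n T / pmf (marginal (snd T) (P n)) z) \<longlonglongrightarrow> 0"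
      using tendsto_divide[OF D_lim marg[OF T, of z]] z by simp
    show "\<forall>\<^sub>F n in sequentially. (sqrt (conditional T (P n) y z) - sqrt (conditional T (F n) y z))\<^sup>2 \<le>
        D n T / pmf (marginal (snd T) (P n)) z"
      using pz by eventually_elim (use D_ge[OF T] in \<open>simp add: le_divide_eq mult.commute\<close>)
  qed simp
  then have "(\<lambda>n. sqrt ((sqrt (conditional T (P n) y z) - sqrt (conditional T (F n) y z))\<^sup>2)) \<longlonglongrightarrow> sqrt 0"
    by (rule tendsto_real_sqrt)
  then have "(\<lambda>n. sqrt (conditional T (P n) y z) - sqrt (conditional T (F n) y z)) \<longlonglongrightarrow> 0"
    by (simp add: tendsto_rabs_zero_iff)
  from tendsto_diff[OF tendsto_real_sqrt[OF cP] this]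
  have "(\<lambda>n. sqrt (conditional T (F n) y z)) \<longlonglongrightarrow> sqrt (conditional T f0 y z)" by simp
  from tendsto_power[OF this, of 2] show "(\<lambda>n. conditional T (F n) y z) \<longlonglongrightarrow> conditional T f0 y z"
    by (simp add: conditional_nonneg)
  \<comment> \<open>Eventually some support point of \<open>P n\<close> has right subvector
    \<open>z\<close>. Since \<open>cond_at\<close> is positive there under \<open>F n\<close>, the
    denominator cannot vanish.\<close>
  show "\<forall>\<^sub>F n in sequentially. 0 < pmf (marginal (snd T) (F n)) z"
    using pz
  proof eventually_elim
    case (elim n)
    then have "z \<in> set_pmf (marginal (snd T) (P n))" by (simp add: set_pmf_iff)
    then obtain x where "x \<in> set_pmf (P n)" "z = restrict x (snd T)" by (auto simp: marginal_def)
    with pos[OF T this(1)] show ?case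
      by (auto simp: cond_at_def conditional_eq_divide zero_less_divide_iff less_le)
  qed
qed

section \<open>Empirical distributions\<close>

definition empirical :: "nat \<Rightarrow> (nat \<Rightarrow> 'a) \<Rightarrow> 'a pmf" where
  "empirical n x = map_pmf x (pmf_of_set {1..n})"

text \<open>An empty sample has no empirical distribution; the later limits are therefore taken
  along \<open>Suc n\<close>.\<close>

lemma set_pmf_empirical: "0 < n \<Longrightarrow> set_pmf (empirical n x) = x ` {1..n}"
  by (simp add: empirical_def set_pmf_of_set)

lemma expectation_empirical:
  fixes g :: "'a \<Rightarrow> real"
  shows "0 < n \<Longrightarrow> measure_pmf.expectation (empirical n x) g = (\<Sum>i\<in>{1..n}. g (x i)) / n"
  by (simp add: empirical_def integral_pmf_of_set)

text \<open>The strong law is applied to \<open>g (X (Suc i) \<omega>)\<close>; countability of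
  \<open>G\<close> yields one common null set.\<close>

lemma (in prob_space) AE_expectation_empirical_tendsto:
  fixes X :: "nat \<Rightarrow> 'a \<Rightarrow> 'b"
  assumes indep: "indep_vars (\<lambda>_. count_space UNIV) X {1..}"
    and distr: "\<And>i. i \<ge> 1 \<Longrightarrow> distr M (count_space UNIV) (X i) = measure_pmf f"
    and "countable G" and int: "\<And>g. g \<in> G \<Longrightarrow> integrable (measure_pmf f) (g :: 'b \<Rightarrow> real)"
  shows "AE \<omega> in M. \<forall>g\<in>G. (\<lambda>n. measure_pmf.expectation (empirical (Suc n) (\<lambda>i. X i \<omega>)) g)
    \<longlonglongrightarrow> measure_pmf.expectation f g"
proof (rule AE_ball_countable[THEN iffD2, OF \<open>countable G\<close>], intro ballI)
  fix g assume "g \<in> G"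
  have X [measurable]: "X (Suc i) \<in> measurable M (count_space UNIV)" for i
    using indep by (auto simp: indep_vars_def)
  have distr_g: "distr M borel (\<lambda>\<omega>. g (X (Suc i) \<omega>)) = distr (measure_pmf f) borel g" for i
    by (subst distr[of "Suc i", symmetric]) (auto simp: distr_distr comp_def)
  have expect: "integrable M (\<lambda>\<omega>. g (X (Suc 0) \<omega>))"
      "expectation (\<lambda>\<omega>. g (X (Suc 0) \<omega>)) = measure_pmf.expectation f g"
  proof -
    have "integrable (distr M (count_space UNIV) (X (Suc 0))) g"
      using int[OF \<open>g \<in> G\<close>] distr[of "Suc 0"] by simp
    then show "integrable M (\<lambda>\<omega>. g (X (Suc 0) \<omega>))" by (subst (asm) integrable_distr_eq) auto
    show "expectation (\<lambda>\<omega>. g (X (Suc 0) \<omega>)) = measure_pmf.expectation f g"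
      using integral_distr[of "X (Suc 0)" M "count_space UNIV" g] distr[of "Suc 0"] by simp
  qed
  have "AE \<omega> in M. (\<lambda>n. (\<Sum>i<n. g (X (Suc i) \<omega>)) / n) \<longlonglongrightarrow> expectation (\<lambda>\<omega>. g (X (Suc 0) \<omega>))"
  proof (rule strong_law_of_large_numbers)
    have "indep_vars (\<lambda>_. count_space UNIV) X (range Suc)"
      by (rule indep_vars_subset[OF indep]) auto
    then have "indep_vars (\<lambda>_. count_space UNIV) (\<lambda>i. X (Suc i)) UNIV"
      using indep_vars_reindex[of Suc UNIV "\<lambda>_. count_space UNIV" X] by (simp add: comp_def)
    then show "indep_vars (\<lambda>_. borel) (\<lambda>i \<omega>. g (X (Suc i) \<omega>)) UNIV"
      by (rule indep_vars_compose2) auto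
  qed (simp_all only: distr_g expect)
  then show "AE \<omega> in M. (\<lambda>n. measure_pmf.expectation (empirical (Suc n) (\<lambda>i. X i \<omega>)) g)
      \<longlonglongrightarrow> measure_pmf.expectation f g"
  proof eventually_elim
    case (elim \<omega>)
    then have "(\<lambda>n. (\<Sum>i<Suc n. g (X (Suc i) \<omega>)) / Suc n) \<longlonglongrightarrow> measure_pmf.expectation f g"
      unfolding expect by (rule LIMSEQ_Suc)
    moreover have "(\<Sum>i<Suc n. g (X (Suc i) \<omega>)) / Suc n = measure_pmf.expectation (empirical (Suc n) (\<lambda>i. X i \<omega>)) g" for n
    proof -
      have "(\<Sum>i\<in>{1..Suc n}. g (X i \<omega>)) = (\<Sum>i<Suc n. g (X (Suc i) \<omega>))"
        by (simp only: One_nat_def sum.atLeast1_atMost_eq)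
      then show ?thesis by (simp only: expectation_empirical[OF zero_less_Suc])
    qed
    ultimately show ?case by simp
  qed
qed

text \<open>Exchanging the sums over sample points and blocks yields empirical expectations.
  Positivity matters because the real \<open>ln 0\<close> is 0 whereas \<open>log_prob 0\<close> is
  \<open>-\<infinity>\<close>.\<close>

lemma log_pseudolikelihood_empirical:
  assumes "0 < n" and w: "\<And>T. T \<in> blocks q \<Longrightarrow> 0 \<le> weight c d T"
    and pos: "\<And>T y. T \<in> {T\<in>blocks q. weight c d T \<noteq> 0} \<Longrightarrow> y \<in> set_pmf (empirical n x) \<Longrightarrow> 0 < cond_at T f y"
  shows "log_pseudolikelihood q c d n x f =
    ereal (n * (\<Sum>T\<in>{T\<in>blocks q. weight c d T \<noteq> 0}. weight c d T *
      measure_pmf.expectation (empirical n x) (\<lambda>y. ln (cond_at T f y))))"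
proof -
  have "log_pseudolikelihood q c d n x f =
      ereal (\<Sum>i\<in>{1..n}. \<Sum>T\<in>blocks q. weight c d T * ln (cond_at T f (x i)))"
    using pos \<open>0 < n\<close> by (intro log_pseudolikelihood_finite) (auto simp: set_pmf_empirical)
  also have "(\<Sum>i\<in>{1..n}. \<Sum>T\<in>blocks q. weight c d T * ln (cond_at T f (x i))) =
      (\<Sum>T\<in>blocks q. weight c d T * (\<Sum>i\<in>{1..n}. ln (cond_at T f (x i))))"
    by (subst sum.swap) (simp add: sum_distrib_left)
  also have "\<dots> = (\<Sum>T\<in>{T\<in>blocks q. weight c d T \<noteq> 0}. weight c d T * (\<Sum>i\<in>{1..n}. ln (cond_at T f (x i))))"
    by (rule sum.mono_neutral_right) (auto simp: finite_blocks)
  also have "\<dots> = n * (\<Sum>T\<in>{T\<in>blocks q. weight c d T \<noteq> 0}. weight c d T *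
      measure_pmf.expectation (empirical n x) (\<lambda>y. ln (cond_at T f y)))"
    using \<open>0 < n\<close> by (subst sum_distrib_left, intro sum.cong) (simp_all add: expectation_empirical)
  finally show ?thesis .
qed

text \<open>The value at \<open>f0\<close> is finite because the sample lies in its support. The
  maximizer's value is at least as large, hence it too gives positive probabilities at the sample
  points, and the comparison becomes one between real numbers.\<close>

lemma max_pseudolikelihood_conditional_tendsto:
  fixes F :: "nat \<Rightarrow> ivec pmf" and x :: "nat \<Rightarrow> ivec"
  assumes w: "\<And>T. T \<in> blocks q \<Longrightarrow> 0 \<le> weight c d T"
    and "f0 \<in> \<F>" and sample: "\<And>i. i \<ge> 1 \<Longrightarrow> x i \<in> set_pmf f0"
    and max: "\<And>n. n \<ge> 1 \<Longrightarrow> is_max_pseudolikelihood q c d \<F> n x (F n)"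
    and joint: "\<And>T y z. T \<in> blocks q \<Longrightarrow> weight c d T \<noteq> 0 \<Longrightarrow>
      (\<lambda>n. pmf (joint T (empirical (Suc n) x)) (y, z)) \<longlonglongrightarrow> pmf (joint T f0) (y, z)"
    and marg: "\<And>T z. T \<in> blocks q \<Longrightarrow> weight c d T \<noteq> 0 \<Longrightarrow>
      (\<lambda>n. pmf (marginal (snd T) (empirical (Suc n) x)) z) \<longlonglongrightarrow> pmf (marginal (snd T) f0) z"
    and int: "\<And>T. T \<in> blocks q \<Longrightarrow> weight c d T \<noteq> 0 \<Longrightarrow>
      integrable (measure_pmf f0) (\<lambda>x. ln (cond_at T f0 x))"
    and ent: "\<And>T. T \<in> blocks q \<Longrightarrow> weight c d T \<noteq> 0 \<Longrightarrow>
      (\<lambda>n. measure_pmf.expectation (empirical (Suc n) x) (\<lambda>y. ln (cond_at T f0 y)))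
        \<longlonglongrightarrow> measure_pmf.expectation f0 (\<lambda>y. ln (cond_at T f0 y))"
    and T: "T \<in> blocks q" "weight c d T \<noteq> 0" and z: "0 < pmf (marginal (snd T) f0) z"
  shows "(\<lambda>n. conditional T (F n) y z) \<longlonglongrightarrow> conditional T f0 y z"
    and "\<forall>\<^sub>F n in sequentially. 0 < pmf (marginal (snd T) (F n)) z"
proof -
  let ?K = "{T\<in>blocks q. weight c d T \<noteq> 0}"
  let ?P = "\<lambda>n. empirical (Suc n) x"
  have supp: "set_pmf (?P n) \<subseteq> set_pmf f0" for n
    using sample by (auto simp: set_pmf_empirical)
  have L0: "log_pseudolikelihood q c d (Suc n) x f0 =
    ereal (Suc n * (\<Sum>T\<in>?K. weight c d T * measure_pmf.expectation (?P n) (\<lambda>y. ln (cond_at T f0 y))))" for n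
    by (rule log_pseudolikelihood_empirical[OF zero_less_Suc w])
       (use supp in \<open>auto simp: cond_at_def intro!: conditional_pos\<close>)
  have le: "log_pseudolikelihood q c d (Suc n) x f0 \<le> log_pseudolikelihood q c d (Suc n) x (F (Suc n))" for n
    using max[of "Suc n"] \<open>f0 \<in> \<F>\<close> by (auto simp: is_max_pseudolikelihood_def)
  have pos: "0 < cond_at T (F (Suc n)) y" if "T \<in> ?K" "y \<in> set_pmf (?P n)" for n T y
  proof -
    have T: "T \<in> blocks q" "weight c d T \<noteq> 0" using \<open>T \<in> ?K\<close> by auto
    have fin: "log_pseudolikelihood q c d (Suc n) x (F (Suc n)) \<noteq> -\<infinity>"
      using le[of n] unfolding L0 by auto
    obtain i where i: "i \<in> {1..Suc n}" "y = x i"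
      using \<open>y \<in> set_pmf (?P n)\<close> unfolding set_pmf_empirical[OF zero_less_Suc] by blast
    show ?thesis
      unfolding i(2) using w fin i(1) T by (rule cond_at_pos_of_log_pseudolikelihood)
  qed
  have L: "log_pseudolikelihood q c d (Suc n) x (F (Suc n)) =
    ereal (Suc n * (\<Sum>T\<in>?K. weight c d T * measure_pmf.expectation (?P n) (\<lambda>y. ln (cond_at T (F (Suc n)) y))))" for n
    by (rule log_pseudolikelihood_empirical[OF zero_less_Suc w pos])
  have max': "(\<Sum>T\<in>?K. weight c d T * measure_pmf.expectation (?P n) (\<lambda>y. ln (cond_at T f0 y))) \<le>
      (\<Sum>T\<in>?K. weight c d T * measure_pmf.expectation (?P n) (\<lambda>y. ln (cond_at T (F (Suc n)) y)))" for n
    using le[of n] unfolding L L0 by (simp del: of_nat_Suc)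
  have fin: "finite (set_pmf (?P n))" for n by (simp add: set_pmf_empirical)
  have w': "0 < weight c d T" if "T \<in> ?K" for T using w[of T] that by auto
  have T': "T \<in> ?K" using T by simp
  have finK: "finite ?K" using finite_blocks by simp
  have K: "T \<in> blocks q" "weight c d T \<noteq> 0" if "T \<in> ?K" for T using that by auto
  \<comment> \<open>Both sequences start at sample size 1; the shift is undone below.\<close>
  note lim = conditional_tendsto[where P = ?P and F = "\<lambda>n. F (Suc n)" and K = ?K and w = "weight c d",
      OF finK w' fin joint[OF K] marg[OF K] int[OF K] ent[OF K] pos max' T' z]
  from lim(1) show "(\<lambda>n. conditional T (F n) y z) \<longlonglongrightarrow> conditional T f0 y z"
    by (rule LIMSEQ_imp_Suc)
  from lim(2) show "\<forall>\<^sub>F n in sequentially. 0 < pmf (marginal (snd T) (F n)) z"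
    by (subst eventually_sequentially_Suc[symmetric])
qed

text \<open>The type of \<open>u\<close> may be uncountable, so the strong law is invoked only on
  the countable support of \<open>map_pmf h f\<close>. Elsewhere both masses are 0, as the sample
  almost surely stays in the support of \<open>f\<close>.\<close>

lemma (in prob_space) AE_pmf_map_empirical_tendsto:
  fixes X :: "nat \<Rightarrow> 'a \<Rightarrow> 'b" and h :: "'b \<Rightarrow> 'c"
  assumes indep: "indep_vars (\<lambda>_. count_space UNIV) X {1..}"
    and distr: "\<And>i. i \<ge> 1 \<Longrightarrow> distr M (count_space UNIV) (X i) = measure_pmf f"
    and sample: "AE \<omega> in M. \<forall>i\<ge>1. X i \<omega> \<in> set_pmf f"
  shows "AE \<omega> in M. \<forall>u. (\<lambda>n. pmf (map_pmf h (empirical (Suc n) (\<lambda>i. X i \<omega>))) u) \<longlonglongrightarrow> pmf (map_pmf h f) u"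
proof -
  let ?G = "(\<lambda>u. indicator (h -` {u}) :: 'b \<Rightarrow> real) ` set_pmf (map_pmf h f)"
  have pmf_eq: "pmf (map_pmf h p) u = measure_pmf.expectation p (indicator (h -` {u}))" for p u
    by (simp add: pmf_map)
  have "AE \<omega> in M. \<forall>g\<in>?G. (\<lambda>n. measure_pmf.expectation (empirical (Suc n) (\<lambda>i. X i \<omega>)) g)
      \<longlonglongrightarrow> measure_pmf.expectation f g"
    by (rule AE_expectation_empirical_tendsto[OF indep distr])
       (auto intro!: integrable_real_indicator simp: less_top[symmetric])
  with sample show ?thesis
  proof eventually_elim
    case (elim \<omega>)
    show ?case
    proof
      fix u
      show "(\<lambda>n. pmf (map_pmf h (empirical (Suc n) (\<lambda>i. X i \<omega>))) u) \<longlonglongrightarrow> pmf (map_pmf h f) u"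
      proof (cases "u \<in> set_pmf (map_pmf h f)")
        case True
        then show ?thesis using elim(2) unfolding pmf_eq by blast
      next
        case False
        then have "u \<notin> set_pmf (map_pmf h (empirical (Suc n) (\<lambda>i. X i \<omega>)))" for n
          using elim(1) by (auto simp: set_pmf_empirical)
        with False show ?thesis by (simp add: pmf_eq_0_set_pmf[THEN iffD2])
      qed
    qed
  qed
qed

theorem theorem1:
  fixes q :: nat
    and \<X> :: "ivec set"
    and \<F> :: "ivec pmf set"
    and c :: "nat set \<Rightarrow> real"
    and d :: "nat set \<times> nat set \<Rightarrow> real"
    and M :: "'w measure"
    and X :: "nat \<Rightarrow> 'w \<Rightarrow> ivec"
    and f0 :: "ivec pmf"
    and f_est :: "nat \<Rightarrow> 'w \<Rightarrow> ivec pmf"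
    and fS_est :: "nat \<Rightarrow> 'w \<Rightarrow> nat set \<Rightarrow> ivec \<Rightarrow> real"
    and fT_est :: "nat \<Rightarrow> 'w \<Rightarrow> nat set \<times> nat set \<Rightarrow> ivec \<Rightarrow> ivec \<Rightarrow> real"
  assumes "\<X> \<subseteq> {1..q} \<rightarrow>\<^sub>E UNIV"
    and "\<And>f. f \<in> \<F> \<Longrightarrow> set_pmf f \<subseteq> \<X>"
    and "\<And>S. S \<in> nonempty_subsets q \<Longrightarrow> c S \<ge> 0"
    and "\<And>T. T \<in> bipartitions q \<Longrightarrow> d T \<ge> 0"
    and "(\<exists>S\<in>nonempty_subsets q. c S \<noteq> 0) \<or> (\<exists>T\<in>bipartitions q. d T \<noteq> 0)"
    and "f0 \<in> \<F>"
    and "prob_space M"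
    and "prob_space.indep_vars M (\<lambda>_. count_space UNIV) X {1..}"
    and "\<And>i. i \<ge> 1 \<Longrightarrow> distr M (count_space UNIV) (X i) = measure_pmf f0"
    and "pseudo_entropy q \<X> c d f0 < \<infinity>"
    and "\<And>n \<omega>. n \<ge> 1 \<Longrightarrow> \<omega> \<in> space M \<Longrightarrow>
           is_max_pseudolikelihood q c d \<F> n (\<lambda>i. X i \<omega>) (f_est n \<omega>)"
    and "\<And>n \<omega>. n \<ge> 1 \<Longrightarrow> \<omega> \<in> space M \<Longrightarrow>
           compatible q \<X> c d (f_est n \<omega>) (fS_est n \<omega>) (fT_est n \<omega>)"
  shows "AE \<omega> in M.
    (\<forall>S\<in>nonempty_subsets q. c S \<noteq> 0 \<longrightarrow>
      (\<forall>x\<in>subvectors \<X> S.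
        (\<lambda>n. fS_est n \<omega> S x) \<longlonglongrightarrow> pmf (marginal S f0) x)) \<and>
    (\<forall>T\<in>bipartitions q. d T \<noteq> 0 \<longrightarrow>
      (\<forall>y\<in>subvectors \<X> (fst T). \<forall>z\<in>subvectors \<X> (snd T).
        pmf (marginal (snd T) f0) z > 0 \<longrightarrow>
        (\<lambda>n. fT_est n \<omega> T y z) \<longlonglongrightarrow> conditional T f0 y z))"
proof -
  interpret prob_space M by fact
  note c = assms(3) and d = assms(4) and distr = assms(9)
  note indep = assms(8)
  have w: "0 \<le> weight c d T" if "T \<in> blocks q" for T
    using that c d by (auto simp: blocks_def weight_def bipartitions_def)
  have int: "integrable (measure_pmf f0) (\<lambda>x. ln (cond_at T f0 x))"
    if "T \<in> blocks q" "weight c d T \<noteq> 0" for T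
    using assms(2)[OF \<open>f0 \<in> \<F>\<close>] assms(10) c d that by (rule integrable_ln_cond_at)
  have sample: "AE \<omega> in M. \<forall>i\<ge>1. X i \<omega> \<in> set_pmf f0"
  proof -
    have "AE \<omega> in M. i \<ge> 1 \<longrightarrow> X i \<omega> \<in> set_pmf f0" for i
    proof (cases "i \<ge> 1")
      case True
      then have [measurable]: "X i \<in> measurable M (count_space UNIV)"
        using indep by (auto simp: indep_vars_def)
      have "AE x in distr M (count_space UNIV) (X i). x \<in> set_pmf f0"
        unfolding distr[OF True] by (simp add: AE_measure_pmf)
      then show ?thesis by (subst (asm) AE_distr_iff) auto
    qed simp
    then show ?thesis by (simp add: AE_all_countable)
  qed
  have joint: "AE \<omega> in M. \<forall>T\<in>blocks q. \<forall>u.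
      (\<lambda>n. pmf (joint T (empirical (Suc n) (\<lambda>i. X i \<omega>))) u) \<longlonglongrightarrow> pmf (joint T f0) u"
    unfolding joint_def
    by (intro AE_finite_allI finite_blocks AE_pmf_map_empirical_tendsto indep distr sample)
  have marg: "AE \<omega> in M. \<forall>T\<in>blocks q. \<forall>u.
      (\<lambda>n. pmf (marginal (snd T) (empirical (Suc n) (\<lambda>i. X i \<omega>))) u) \<longlonglongrightarrow> pmf (marginal (snd T) f0) u"
    unfolding marginal_def
    by (intro AE_finite_allI finite_blocks AE_pmf_map_empirical_tendsto indep distr sample)
  have "AE \<omega> in M. \<forall>g\<in>(\<lambda>T x. ln (cond_at T f0 x)) ` {T\<in>blocks q. weight c d T \<noteq> 0}.
      (\<lambda>n. measure_pmf.expectation (empirical (Suc n) (\<lambda>i. X i \<omega>)) g) \<longlonglongrightarrow> measure_pmf.expectation f0 g"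
    by (rule AE_expectation_empirical_tendsto[OF indep distr])
       (use int finite_blocks in \<open>auto intro: countable_finite\<close>)
  \<comment> \<open>From here on the argument concerns a single outcome outside a null set.\<close>
  with sample joint marg AE_space show ?thesis
  proof eventually_elim
    case (elim \<omega>)
    have lim: "(\<lambda>n. conditional T (f_est n \<omega>) y z) \<longlonglongrightarrow> conditional T f0 y z"
      "\<forall>\<^sub>F n in sequentially. 0 < pmf (marginal (snd T) (f_est n \<omega>)) z"
      if T: "T \<in> blocks q" "weight c d T \<noteq> 0" and z: "0 < pmf (marginal (snd T) f0) z" for T y z
      using max_pseudolikelihood_conditional_tendsto[where F = "\<lambda>n. f_est n \<omega>" and x = "\<lambda>i. X i \<omega>" and \<F> = \<F>,
          OF w \<open>f0 \<in> \<F>\<close> _ assms(11) _ _ int _ T z] elim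
      by auto
    show ?case
    proof (intro conjI ballI impI)
      fix S x assume S: "S \<in> nonempty_subsets q" "c S \<noteq> 0" and x: "x \<in> subvectors \<X> S"
      have "(\<lambda>n. pmf (marginal S (f_est n \<omega>)) x) \<longlonglongrightarrow> pmf (marginal S f0) x"
        using lim(1)[of "(S, {})" "\<lambda>_. undefined" x] S
        by (simp add: blocks_def weight_def marginal_empty conditional_empty)
      then show "(\<lambda>n. fS_est n \<omega> S x) \<longlonglongrightarrow> pmf (marginal S f0) x"
      proof (rule Lim_transform_eventually)
        \<comment> \<open>The estimates are constrained only from sample size 1 on.\<close>
        show "\<forall>\<^sub>F n in sequentially. pmf (marginal S (f_est n \<omega>)) x = fS_est n \<omega> S x"
          using eventually_ge_at_top[of 1]
          by eventually_elim (use assms(12) elim S x in \<open>auto simp: compatible_def\<close>)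
      qed
    next
      fix T y z assume T: "T \<in> bipartitions q" "d T \<noteq> 0" and y: "y \<in> subvectors \<X> (fst T)"
        and z: "z \<in> subvectors \<X> (snd T)" "0 < pmf (marginal (snd T) f0) z"
      have T': "T \<in> blocks q" "weight c d T \<noteq> 0"
        using T by (auto simp: blocks_def weight_def bipartitions_def)
      show "(\<lambda>n. fT_est n \<omega> T y z) \<longlonglongrightarrow> conditional T f0 y z"
      proof (rule Lim_transform_eventually[OF lim(1)[OF T' z(2)]])
        \<comment> \<open>Compatibility speaks about \<open>z\<close> only when its estimated
          marginal probability is positive, which \<open>lim(2)\<close> ensures eventually.\<close>
        show "\<forall>\<^sub>F n in sequentially. conditional T (f_est n \<omega>) y z = fT_est n \<omega> T y z"
          using lim(2)[OF T' z(2)] eventually_ge_at_top[of 1]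
          by eventually_elim (use assms(12) elim T y z in \<open>auto simp: compatible_def\<close>)
      qed
    qed
  qed
qed

end
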